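(* Assume $\Phi=(\Phi_1,\dots,\Phi_m)$ is continuous. For any positive real numbers $\bar z$ and $\bar u$ and any $\epsilon>0$, there exist a choice of $(L_1,\dots,L_m)$, a class $\mathcal{KL}$ function $\beta$ and two class $\mathcal K_\infty$ functions $\gamma_1,\gamma_2$ such that, for all locally bounded time functions $(u,v,w,\hat w)$, for every $z\in\mathbb R^m$ and every observer initial condition $(\hat{\mathbf z}_1,\dots,\hat{\mathbf z}_m)\in\mathbb R^1\times\mathbb R^2\times\cdots\times\mathbb R^m$, and for all $t\ge 0$ such that $|Z(z,s;u,w)|\le\bar z$ and $|u(s)|\le\bar u$ for all $0\le s\le t$, any solution $(\hat{\mathbf Z}_1(t),\dots,\hat{\mathbf Z}_m(t))$ of the cascaded high gain observer (see context) verifies, for all $i\in\{1,\dots,m\}$, $$|\hat{\mathbf Z}_i(t)-\mathbf Z_i(t)|\le\max\left\{\epsilon,\ \beta\Big(\sum_{j=1}^i|\hat{\mathbf z}_j-\mathbf z_j|,\,t\Big),\ \sup_{s\in[0,t]}\big\{\gamma_1(|v(s)|),\gamma_2(|\Delta w(s)|)\big\}\right\},$$ where $\mathbf z_j=(z_1,\dots,z_j)$, $\mathbf Z_i(t)=(Z_1(z,t;u,w),\dots,Z_i(z,t;u,w))$ and $\Delta w=\hat w-w$.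
   Context: System: $\dot z_i=z_{i+1}+\Phi_i(u,z_1,\dots,z_i)+w_i$ for $1\le i\le m-1$, $\dot z_m=\Phi_m(u,z)+w_m$, with measured output $y=z_1+v\in\mathbb R$. Here $z\in\mathbb R^m$ is the state, $u(t)\in\mathbb R^p$ the input, $w(t)\in\mathbb R^m$ a disturbance on the dynamics, $v(t)\in\mathbb R$ a disturbance on the measurement, $\hat w(t)\in\mathbb R^m$ an approximation of $w$, and $\Phi_i:\mathbb R^p\times\mathbb R^i\to\mathbb R$. All time functions are measurable and locally bounded on $[0,+\infty)$. $Z(z,t;u,w)$ denotes a solution of the system equal to $z$ at time $0$; standing assumption: such solutions are defined for all $t\ge0$. Cascaded high gain observer: it is made of $m$ blocks; block $i$ has state $\hat{\mathbf z}_i=(\hat z_{i1},\dots,\hat z_{ii})\in\mathbb R^i$ and dynamics $$\dot{\hat z}_{ij}=\hat z_{i(j+1)}+\Phi_j(u,\hat z_{(i-1)1},\dots,\hat z_{(i-1)j})+\hat w_j-L_i^j\,k_{ij}\,(\hat z_{i1}-y),\quad 1\le j\le i-1,$$ $$\dot{\hat z}_{ii}=\hat w_i-L_i^i\,k_{ii}\,(\hat z_{i1}-y).$$ (Block $1$ is $\dot{\hat z}_{11}=\hat w_1-L_1k_{11}(\hat z_{11}-y)$.) The gains $k_{i1},\dots,k_{ii}$ are chosen as in a classical high gain observer of dimension $i$, i.e. such that $s^i+k_{i1}s^{i-1}+\dots+k_{ii}$ is a Hurwitz polynomial; the $L_i>0$ are the high gain parameters. $\hat{\mathbf Z}_i(t)$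 denotes the state at time $t$ of block $i$ along a solution of the observer with initial condition $(\hat{\mathbf z}_1,\dots,\hat{\mathbf z}_m)$ at time $0$, driven by $u$, $\hat w$ and $y(t)=Z_1(z,t;u,w)+v(t)$. *)

theory Defs
  imports "HOL-Analysis.Analysis" "HOL-Computational_Algebra.Polynomial"
begin

text \<open>
  Since blocks of all dimensions \<open>1, \<dots>, m\<close> occur simultaneously, a vector of
  \<open>\<real>\<^sup>i\<close> is a function on \<^typ>\<open>nat\<close> of which only the values at \<open>1, \<dots>, i\<close> matter.
  Its Euclidean norm is \<open>L2_set x {1..i}\<close>. Where a function of a vector of \<open>\<real>\<^sup>i\<close>
  is required (the maps \<open>\<Phi> i\<close>), \<open>\<real>\<^sup>i\<close> is \<open>{1..i} \<rightarrow>\<^sub>E UNIV\<close>, whose topology as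
  a subspace of \<^typ>\<open>nat \<Rightarrow> real\<close> (product topology) is that of \<open>\<real>\<^sup>i\<close>.
\<close>

definition Phi_continuous ::
    "nat \<Rightarrow> (nat \<Rightarrow> real^'p \<Rightarrow> (nat \<Rightarrow> real) \<Rightarrow> real) \<Rightarrow> bool" where
  "Phi_continuous m \<Phi> \<longleftrightarrow>
     (\<forall>i\<in>{1..m}. continuous_on (UNIV \<times> ({1..i} \<rightarrow>\<^sub>E UNIV)) (\<lambda>(u, x). \<Phi> i u x))"

definition admissible_signal :: "(real \<Rightarrow> 'a::euclidean_space) \<Rightarrow> bool" where
  "admissible_signal f \<longleftrightarrow>
     f \<in> borel_measurable (lebesgue_on {0..}) \<and> (\<forall>T\<ge>0. bounded (f ` {0..T}))"

text \<open>
  Time functions are only measurable, so solutions of differential equations are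
  meant in the sense of Caratheodory. On an interval \<open>I\<close> with left end \<open>0\<close>, the
  function \<open>x\<close> is absolutely continuous with derivative \<open>r\<close> almost everywhere iff it
  is an indefinite Lebesgue integral of \<open>r\<close>.
\<close>

definition integral_curve :: "real set \<Rightarrow> (real \<Rightarrow> real) \<Rightarrow> (real \<Rightarrow> real) \<Rightarrow> bool" where
  "integral_curve I r x \<longleftrightarrow>
     (\<forall>t\<in>I. r absolutely_integrable_on {0..t} \<and> (r has_integral (x t - x 0)) {0..t})"

definition system_rhs ::
    "nat \<Rightarrow> (nat \<Rightarrow> real^'p \<Rightarrow> (nat \<Rightarrow> real) \<Rightarrow> real) \<Rightarrow>
     real^'p \<Rightarrow> (nat \<Rightarrow> real) \<Rightarrow> (nat \<Rightarrow> real) \<Rightarrow> nat \<Rightarrow> real" where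
  "system_rhs m \<Phi> u w z i =
     (if i < m then z (i + 1) + \<Phi> i u (restrict z {1..i}) + w i
      else \<Phi> m u (restrict z {1..m}) + w m)"

definition system_solution ::
    "nat \<Rightarrow> (nat \<Rightarrow> real^'p \<Rightarrow> (nat \<Rightarrow> real) \<Rightarrow> real) \<Rightarrow>
     (real \<Rightarrow> real^'p) \<Rightarrow> (real \<Rightarrow> nat \<Rightarrow> real) \<Rightarrow> real set \<Rightarrow>
     (nat \<Rightarrow> real) \<Rightarrow> (real \<Rightarrow> nat \<Rightarrow> real) \<Rightarrow> bool" where
  "system_solution m \<Phi> u w I z Z \<longleftrightarrow>
     (\<forall>i\<in>{1..m}. Z 0 i = z i \<and>
        integral_curve I (\<lambda>s. system_rhs m \<Phi> (u s) (w s) (Z s) i) (\<lambda>s. Z s i))"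

definition forward_complete ::
    "nat \<Rightarrow> (nat \<Rightarrow> real^'p \<Rightarrow> (nat \<Rightarrow> real) \<Rightarrow> real) \<Rightarrow> bool" where
  "forward_complete m \<Phi> \<longleftrightarrow>
     (\<forall>u w z Z T. admissible_signal u \<and> (\<forall>i\<in>{1..m}. admissible_signal (\<lambda>t. w t i)) \<and>
        0 < T \<and> system_solution m \<Phi> u w {0..<T} z Z \<longrightarrow>
        (\<exists>Z'. system_solution m \<Phi> u w {0..} z Z' \<and>
              (\<forall>t\<in>{0..<T}. \<forall>i\<in>{1..m}. Z' t i = Z t i)))"

text \<open>In the observer state \<open>zh\<close>, the \<open>j\<close>-th component of block \<open>i\<close> is \<open>zh i j\<close>.\<close>

definition observer_rhs ::
    "(nat \<Rightarrow> real^'p \<Rightarrow> (nat \<Rightarrow> real) \<Rightarrow> real) \<Rightarrow> (nat \<Rightarrow> nat \<Rightarrow> real) \<Rightarrow> (nat \<Rightarrow> real) \<Rightarrow>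
     real^'p \<Rightarrow> (nat \<Rightarrow> real) \<Rightarrow> real \<Rightarrow> (nat \<Rightarrow> nat \<Rightarrow> real) \<Rightarrow> nat \<Rightarrow> nat \<Rightarrow> real" where
  "observer_rhs \<Phi> k L u wh y zh i j =
     (if j < i then zh i (j + 1) + \<Phi> j u (restrict (zh (i - 1)) {1..j}) + wh j
                    - L i ^ j * k i j * (zh i 1 - y)
      else wh i - L i ^ i * k i i * (zh i 1 - y))"

definition observer_solution ::
    "nat \<Rightarrow> (nat \<Rightarrow> real^'p \<Rightarrow> (nat \<Rightarrow> real) \<Rightarrow> real) \<Rightarrow> (nat \<Rightarrow> nat \<Rightarrow> real) \<Rightarrow> (nat \<Rightarrow> real) \<Rightarrow>
     (real \<Rightarrow> real^'p) \<Rightarrow> (real \<Rightarrow> nat \<Rightarrow> real) \<Rightarrow> (real \<Rightarrow> real) \<Rightarrow> real set \<Rightarrow>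
     (nat \<Rightarrow> nat \<Rightarrow> real) \<Rightarrow> (real \<Rightarrow> nat \<Rightarrow> nat \<Rightarrow> real) \<Rightarrow> bool" where
  "observer_solution m \<Phi> k L u wh y I zh Zh \<longleftrightarrow>
     (\<forall>i\<in>{1..m}. \<forall>j\<in>{1..i}. Zh 0 i j = zh i j \<and>
        integral_curve I (\<lambda>s. observer_rhs \<Phi> k L (u s) (wh s) (y s) (Zh s) i j)
          (\<lambda>s. Zh s i j))"

definition hurwitz :: "real poly \<Rightarrow> bool" where
  "hurwitz p \<longleftrightarrow> (\<forall>s::complex. poly (map_poly complex_of_real p) s = 0 \<longrightarrow> Re s < 0)"

definition gain_poly :: "(nat \<Rightarrow> nat \<Rightarrow> real) \<Rightarrow> nat \<Rightarrow> real poly" where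
  "gain_poly k i = monom 1 i + (\<Sum>j=1..i. monom (k i j) (i - j))"

text \<open>Comparison functions live on \<open>[0, \<infinity>)\<close>; values at negative arguments are irrelevant.\<close>

definition class_K :: "(real \<Rightarrow> real) \<Rightarrow> bool" where
  "class_K \<gamma> \<longleftrightarrow> continuous_on {0..} \<gamma> \<and> strict_mono_on {0..} \<gamma> \<and> \<gamma> 0 = 0"

definition class_K_inf :: "(real \<Rightarrow> real) \<Rightarrow> bool" where
  "class_K_inf \<gamma> \<longleftrightarrow> class_K \<gamma> \<and> filterlim \<gamma> at_top at_top"

definition class_KL :: "(real \<Rightarrow> real \<Rightarrow> real) \<Rightarrow> bool" where
  "class_KL \<beta> \<longleftrightarrow>
     continuous_on ({0..} \<times> {0..}) (\<lambda>(r, t). \<beta> r t) \<and>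
     (\<forall>t\<ge>0. class_K (\<lambda>r. \<beta> r t)) \<and>
     (\<forall>r\<ge>0. antimono_on {0..} (\<beta> r) \<and> (\<beta> r \<longlongrightarrow> 0) at_top)"

end

theory Submission
  imports Defs "HOL-Computational_Algebra.Fundamental_Theorem_Algebra"
begin

text \<open>
  The error of block \<open>i\<close>, scaled by powers of \<open>L i\<close>, is a Hurwitz companion system sped up by
  \<open>L i\<close>. The ignored drift \<open>z\<^bsub>i+1\<^esub> + \<Phi>\<^sub>i\<close>, bounded by a constant that depends only on the
  bounds on state and input, enters it only through the last component, so that its effect
  is of order \<open>1 / L i\<close>. The terms \<open>\<Phi>\<^sub>j(u, z + e) - \<Phi>\<^sub>j(u, z)\<close>, with \<open>e\<close> the error of block
  \<open>i - 1\<close>, are amplified by powers of \<open>L i\<close>; but \<open>L i\<close> is fixed before the tolerance of block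
  \<open>i - 1\<close>, hence the gains are chosen from \<open>L m\<close> down to \<open>L 1\<close>.

  The functions \<open>\<Phi>\<^sub>j\<close> are merely continuous, but because of the tolerance one may bound these
  terms by \<open>\<eta> + q(|e|)\<close> with \<open>q\<close> of class K and star-shaped, \<open>q(c x) \<le> c q(x)\<close> for
  \<open>0 \<le> c \<le> 1\<close>. Such a \<open>q\<close> preserves bounds \<open>\<phi>(r) exp(-t)\<close>, so the transients of all blocks
  have this form, with rate one once every \<open>L i\<close> is large enough.
\<close>

section \<open>Scalar linear equations in the sense of Caratheodory\<close>

lemma has_integral_increment:
  fixes x r :: "real \<Rightarrow> 'a::banach"
  assumes x: "\<And>t. t \<in> {0..T} \<Longrightarrow> (r has_integral (x t - x 0)) {0..t}"
    and "0 \<le> s" "s \<le> t" "t \<le> T"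
  shows "(r has_integral (x t - x s)) {s..t}"
proof -
  have "r integrable_on {0..t}"
    using has_integral_integrable[OF x[of t]] assms by auto
  moreover have "integral {0..s} r + integral {s..t} r = integral {0..t} r"
    using assms calculation by (intro Henstock_Kurzweil_Integration.integral_combine) auto
  then have "integral {s..t} r = integral {0..t} r - integral {0..s} r"
    by (simp add: eq_diff_eq add.commute)
  moreover have "integral {0..s} r = x s - x 0" "integral {0..t} r = x t - x 0"
    using x[of s] x[of t] assms by (auto simp: integral_unique)
  ultimately have "integral {s..t} r = x t - x s" "r integrable_on {s..t}"
    using assms integrable_subinterval_real[of r 0 t s t] by auto
  then show ?thesis
    by (metis integrable_integral)
qed

lemma continuous_on_indefinite_integral:
  fixes x r :: "real \<Rightarrow> 'a::banach"
  assumes "0 \<le> T" and x: "\<And>t. t \<in> {0..T} \<Longrightarrow> (r has_integral (x t - x 0)) {0..t}"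
  shows "continuous_on {0..T} x"
proof -
  have "continuous_on {0..T} (\<lambda>t. x 0 + integral {0..t} r)"
    using x[of T] assms(1) by (intro continuous_intros indefinite_integral_continuous_1) auto
  moreover have "x 0 + integral {0..t} r = x t" if "t \<in> {0..T}" for t
    using x[OF that] by (simp add: integral_unique)
  ultimately show ?thesis
    by (rule continuous_on_eq)
qed

text \<open>
  Past the last time \<open>s\<close> at which \<open>norm (x s) \<le> m s\<close>, the bound
  \<open>m s * norm (1 + (t - s) * c) + \<integral> (norm c * norm (x \<tau> - x s) + F \<tau>)\<close> on \<open>norm (x t)\<close>
  grows strictly slower than \<open>m\<close>; this avoids differentiating \<open>norm (x t)\<close>, which is
  only absolutely continuous.
\<close>

lemma comparison:
  fixes x f :: "real \<Rightarrow> complex" and c :: complex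
  assumes x: "\<And>t. t \<in> {0..T} \<Longrightarrow> ((\<lambda>s. c * x s + f s) has_integral (x t - x 0)) {0..t}"
    and f: "\<And>t. t \<in> {0..T} \<Longrightarrow> norm (f t) \<le> F t"
    and F: "continuous_on {0..T} F"
    and m: "\<And>t. t \<in> {0..T} \<Longrightarrow> (m has_real_derivative m' t) (at t)"
    and m': "\<And>t. t \<in> {0..T} \<Longrightarrow> Re c * m t + F t < m' t"
    and init: "norm (x 0) \<le> m 0"
    and t: "t \<in> {0..T}"
  shows "norm (x t) \<le> m t"
proof (rule ccontr)
  assume "\<not> norm (x t) \<le> m t"
  then have gt: "norm (x t) > m t" by simp
  have T: "0 \<le> T" using t by auto
  have cx: "continuous_on {0..T} x"
    by (rule continuous_on_indefinite_integral[OF T x])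
  have cm: "continuous_on {0..T} m"
    by (meson DERIV_continuous continuous_at_imp_continuous_on m)
  define A where "A = {s \<in> {0..t}. norm (x s) - m s \<le> 0}"
  have "continuous_on {0..t} (\<lambda>s. norm (x s) - m s)"
    using t by (intro continuous_intros continuous_on_subset[OF cx] continuous_on_subset[OF cm]) auto
  then have "closed A"
    unfolding A_def by (intro continuous_on_closed_Collect_le continuous_on_const) auto
  moreover have "0 \<in> A" using init t by (auto simp: A_def)
  moreover have bA: "bdd_above A" by (auto simp: A_def bdd_above_def)
  ultimately have "Sup A \<in> A" by (intro closed_contains_Sup) auto
  define s where "s = Sup A"
  have sA: "s \<in> A" using \<open>Sup A \<in> A\<close> by (simp add: s_def)
  then have s: "0 \<le> s" "s < t" "norm (x s) \<le> m s"
    using gt by (auto simp: A_def less_le)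
  have after: "norm (x \<tau>) > m \<tau>" if "s < \<tau>" "\<tau> \<le> t" for \<tau>
  proof (rule ccontr)
    assume "\<not> norm (x \<tau>) > m \<tau>"
    then have "\<tau> \<in> A" using that s by (auto simp: A_def)
    then have "\<tau> \<le> s" unfolding s_def using bA by (rule cSup_upper)
    then show False using that by simp
  qed
  \<comment> \<open>\<open>G\<close> bounds the integrand that remains when the linear part is
    frozen at \<open>x s\<close>. It is continuous although \<open>f\<close> need not be, and
    \<open>G s = F s\<close>.\<close>
  define G where "G \<tau> = norm c * norm (x \<tau> - x s) + F \<tau>" for \<tau>
  have cG: "continuous_on {s..t} G"
    unfolding G_def using t s
    by (intro continuous_intros continuous_on_subset[OF cx] continuous_on_subset[OF F]) auto
  have bound: "norm (x \<tau>) \<le> m s * norm (1 + of_real (\<tau> - s) * c) + integral {s..\<tau>} G"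
    if \<tau>: "\<tau> \<in> {s..t}" for \<tau>
  proof -
    have "((\<lambda>r. c * x r + f r) has_integral (x \<tau> - x s)) {s..\<tau>}"
      by (rule has_integral_increment[where T = T, OF x]) (use s \<tau> t in auto)
    moreover have "((\<lambda>r. c * x s) has_integral of_real (\<tau> - s) * (c * x s)) {s..\<tau>}"
      using has_integral_const_real[of "c * x s" s \<tau>] \<tau> by (simp add: scaleR_conv_of_real)
    ultimately have I: "((\<lambda>r. c * x r + f r - c * x s) has_integral
        (x \<tau> - x s - of_real (\<tau> - s) * (c * x s))) {s..\<tau>}"
      by (rule has_integral_diff)
    have "norm (integral {s..\<tau>} (\<lambda>r. c * x r + f r - c * x s)) \<le> integral {s..\<tau>} G"
    proof (rule integral_norm_bound_integral)
      show "(\<lambda>r. c * x r + f r - c * x s) integrable_on {s..\<tau>}" using I by blast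
      show "G integrable_on {s..\<tau>}"
        using \<tau> by (intro integrable_continuous_real continuous_on_subset[OF cG]) auto
      fix r assume "r \<in> {s..\<tau>}"
      then have "norm (f r) \<le> F r" using f s \<tau> t by auto
      moreover have "c * x r + f r - c * x s = c * (x r - x s) + f r" by (simp add: algebra_simps)
      ultimately show "norm (c * x r + f r - c * x s) \<le> G r"
        unfolding G_def by (metis add_left_mono norm_mult norm_triangle_le)
    qed
    then have "norm (x \<tau> - x s - of_real (\<tau> - s) * (c * x s)) \<le> integral {s..\<tau>} G"
      using I by (simp add: integral_unique)
    moreover have "x \<tau> = x s * (1 + of_real (\<tau> - s) * c) + (x \<tau> - x s - of_real (\<tau> - s) * (c * x s))"
      by (simp add: algebra_simps)
    then have "norm (x \<tau>) \<le> norm (x s) * norm (1 + of_real (\<tau> - s) * c)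
       + norm (x \<tau> - x s - of_real (\<tau> - s) * (c * x s))"
      by (metis norm_mult norm_triangle_ineq)
    moreover have "norm (x s) * norm (1 + of_real (\<tau> - s) * c) \<le> m s * norm (1 + of_real (\<tau> - s) * c)"
      using s by (intro mult_right_mono) auto
    ultimately show ?thesis by linarith
  qed
  \<comment> \<open>\<open>P\<close> dominates \<open>norm (x \<tau>) - m \<tau>\<close> past
    \<open>s\<close> and vanishes at \<open>s\<close>. As \<open>norm (1 + h * c)\<close> has right
    derivative \<open>Re c\<close> at \<open>h = 0\<close>, its slope there is
    \<open>Re c * m s + F s - m' s < 0\<close>, so \<open>norm (x \<tau>)\<close> lies below
    \<open>m\<close> just after \<open>s\<close>.\<close>
  define P where "P \<tau> = m s * norm (1 + of_real (\<tau> - s) * c) + integral {s..\<tau>} G - m \<tau>" for \<tau>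
  have "((\<lambda>\<tau>. sqrt ((1 + (\<tau> - s) * Re c)\<^sup>2 + ((\<tau> - s) * Im c)\<^sup>2)) has_real_derivative Re c) (at s within {s..t})"
    by (auto intro!: derivative_eq_intros)
  moreover have "norm (1 + of_real (\<tau> - s) * c) = sqrt ((1 + (\<tau> - s) * Re c)\<^sup>2 + ((\<tau> - s) * Im c)\<^sup>2)" for \<tau>
    by (simp add: cmod_def)
  ultimately have dn: "((\<lambda>\<tau>. norm (1 + of_real (\<tau> - s) * c)) has_real_derivative Re c) (at s within {s..t})"
    by simp
  have dG: "((\<lambda>\<tau>. integral {s..\<tau>} G) has_real_derivative G s) (at s within {s..t})"
    using s by (intro integral_has_real_derivative[OF cG]) auto
  have dm: "(m has_real_derivative m' s) (at s within {s..t})"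
    using s t by (intro has_field_derivative_at_within[OF m]) auto
  have "(P has_real_derivative m s * Re c + G s - m' s) (at s within {s..t})"
    unfolding P_def using DERIV_diff[OF DERIV_add[OF DERIV_cmult[OF dn] dG] dm] .
  moreover have "m s * Re c + G s - m' s < 0"
    using m'[of s] s t by (simp add: G_def algebra_simps)
  ultimately obtain d where d: "d > 0" "\<And>h. h > 0 \<Longrightarrow> s + h \<in> {s..t} \<Longrightarrow> h < d \<Longrightarrow> P (s + h) < P s"
    using has_real_derivative_neg_dec_right by blast
  define h where "h = min (d/2) (t - s)"
  have h: "h > 0" "h < d" "s + h \<in> {s..t}" using d s by (auto simp: h_def min_def)
  have "P (s + h) < P s" using d h by blast
  moreover have "P s = 0" by (simp add: P_def)
  moreover have "norm (x (s + h)) - m (s + h) \<le> P (s + h)"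
    using bound[OF h(3)] by (simp add: P_def)
  moreover have "norm (x (s + h)) > m (s + h)" using after h by auto
  ultimately show False by linarith
qed

text \<open>With \<open>a = - Re c\<close>, damping removes twice the input from the barrier term
  \<open>2 * (F0 + F1 * exp (- t)) / a\<close>. Since \<open>a >= 2\<close>, the surplus pays for
  the derivative of the decaying part, so the rate one of the input survives.\<close>

lemma scalar_bound:
  fixes x f :: "real \<Rightarrow> complex" and c :: complex
  assumes x: "\<And>t. t \<in> {0..T} \<Longrightarrow> ((\<lambda>s. c * x s + f s) has_integral (x t - x 0)) {0..t}"
    and f: "\<And>t. t \<in> {0..T} \<Longrightarrow> norm (f t) \<le> F0 + F1 * exp (- t)"
    and F: "0 \<le> F0" "0 \<le> F1"
    and c: "Re c \<le> - 2"
    and t: "t \<in> {0..T}"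
  shows "norm (x t) \<le> norm (x 0) * exp (- t) + 2 * (F0 + F1 * exp (- t)) / - Re c"
proof -
  define a where "a = - Re c"
  have a: "a \<ge> 2" using c by (simp add: a_def)
  \<comment> \<open>The slack \<kappa> makes the differential inequality strict even when all other
    terms vanish.\<close>
  have "norm (x t) \<le> norm (x 0) * exp (- t) + 2 * (F0 + F1 * exp (- t)) / a + \<kappa>" if \<kappa>: "\<kappa> > 0" for \<kappa>
  proof (rule comparison[OF x f _ _ _ _ t, where m = "\<lambda>t. norm (x 0) * exp (- t) + 2 * (F0 + F1 * exp (- t)) / a + \<kappa>"
        and m' = "\<lambda>t. - norm (x 0) * exp (- t) - 2 * F1 * exp (- t) / a"])
    show "continuous_on {0..T} (\<lambda>t. F0 + F1 * exp (- t))" by (intro continuous_intros)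
    show "norm (x 0) \<le> norm (x 0) * exp (- 0) + 2 * (F0 + F1 * exp (- 0)) / a + \<kappa>"
      using F a \<kappa> by simp
    fix s
    show "((\<lambda>t. norm (x 0) * exp (- t) + 2 * (F0 + F1 * exp (- t)) / a + \<kappa>) has_real_derivative
       - norm (x 0) * exp (- s) - 2 * F1 * exp (- s) / a) (at s)"
      using a by (auto intro!: derivative_eq_intros)
    have arith: "X + (F0 + Y) < p - q"
      if "N \<le> A" "y \<le> Y * 1" "0 < K" "X = - A - B - K" "B = 2 * F0 + 2 * Y" "q = y" "p = - N"
      for X Y p q N A y K B
      using that F(1) by linarith
    define E where "E = exp (- s)"
    have E: "E > 0" by (simp add: E_def)
    have "norm (x 0) * E \<le> a * (norm (x 0) * E)"
      using a E mult_right_mono[of 1 a "norm (x 0) * E"] by simp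
    moreover have "F1 * E * (2 / a) \<le> F1 * E * 1"
      using a E F by (intro mult_left_mono) auto
    moreover have "a * \<kappa> > 0" using a \<kappa> by simp
    moreover have "Re c * (X + Y + \<kappa>) = - (a * X) - a * Y - a * \<kappa>" for X Y
      by (simp add: a_def algebra_simps)
    then have "Re c * (norm (x 0) * E + 2 * (F0 + F1 * E) / a + \<kappa>)
       = - (a * (norm (x 0) * E)) - a * (2 * (F0 + F1 * E) / a) - a * \<kappa>" .
    moreover have "a * (2 * (F0 + F1 * E) / a) = 2 * F0 + 2 * (F1 * E)" using a by (simp add: field_simps)
    moreover have "2 * F1 * E / a = F1 * E * (2 / a)" "- norm (x 0) * E = - (norm (x 0) * E)" by simp_all
    ultimately show "Re c * (norm (x 0) * exp (- s) + 2 * (F0 + F1 * exp (- s)) / a + \<kappa>)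
        + (F0 + F1 * exp (- s)) < - norm (x 0) * exp (- s) - 2 * F1 * exp (- s) / a"
      unfolding E_def[symmetric] by (rule arith)
  qed auto
  then show ?thesis unfolding a_def by (rule field_le_epsilon)
qed

section \<open>Hurwitz companion systems\<close>

text \<open>\<open>coeff (reflect_poly p) j\<close> is the coefficient of
  \<open>s ^ (degree p - j)\<close>. For monic \<open>p\<close> this is the observer form:
  \<open>L\<close> times a companion matrix with characteristic polynomial \<open>p\<close>, driven
  by \<open>f\<close>.\<close>

definition companion_solution ::
    "complex poly \<Rightarrow> real \<Rightarrow> real \<Rightarrow> (nat \<Rightarrow> real \<Rightarrow> complex) \<Rightarrow> (nat \<Rightarrow> real \<Rightarrow> complex) \<Rightarrow> bool" where
  "companion_solution p L T x f \<longleftrightarrow>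
     (\<forall>j\<in>{1..degree p}. \<forall>t\<in>{0..T}.
        ((\<lambda>s. of_real L * ((if j < degree p then x (Suc j) s else 0) - coeff (reflect_poly p) j * x 1 s) + f j s)
          has_integral (x j t - x j 0)) {0..t})"

fun horner_partial :: "'a::comm_ring_1 \<Rightarrow> (nat \<Rightarrow> 'a) \<Rightarrow> nat \<Rightarrow> 'a" where
  "horner_partial c x 0 = 0"
| "horner_partial c x (Suc j) = x (Suc j) + c * horner_partial c x j"

lemma norm_horner_partial_le:
  fixes c :: "'a::{real_normed_algebra_1, comm_ring_1}"
  assumes "\<And>i. i \<in> {1..j} \<Longrightarrow> norm (x i) \<le> E" "0 \<le> E"
  shows "norm (horner_partial c x j) \<le> (1 + norm c) ^ j * E"
  using assms(1)
proof (induction j)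
  case 0
  then show ?case using assms(2) by simp
next
  case (Suc j)
  define M where "M = (1 + norm c) ^ j"
  have M: "M \<ge> 1" by (simp add: M_def)
  have "norm (c * horner_partial c x j) \<le> norm c * (M * E)"
    unfolding M_def using Suc by (intro order.trans[OF norm_mult_ineq] mult_left_mono) auto
  moreover have "norm (x (Suc j)) \<le> E" using Suc.prems by simp
  ultimately have "norm (horner_partial c x (Suc j)) \<le> E + norm c * (M * E)"
    by (simp add: norm_triangle_le)
  moreover have "E \<le> M * E" using M assms(2) mult_right_mono[of 1 M E] by simp
  ultimately show ?case unfolding M_def[symmetric] by (simp add: M_def[symmetric] algebra_simps)
qed

text \<open>Reversal turns the factor \<open>s - c\<close> into \<open>1 - c * s\<close>, so
  reversed coefficients obey the recursion of synthetic division in the order of the state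
  variables.\<close>

lemma coeff_reflect_poly_linear_mult:
  fixes q :: "'a::idom poly"
  shows "coeff (reflect_poly ([:- c, 1:] * q)) (Suc j) = coeff (reflect_poly q) (Suc j) - c * coeff (reflect_poly q) j"
proof -
  have "reflect_poly [:- c, 1:] = [:1, - c:]"
    by (simp add: reflect_poly_def)
  then have "reflect_poly ([:- c, 1:] * q) = [:1, - c:] * reflect_poly q"
    by (simp add: reflect_poly_mult del: mult_pCons_left)
  then show ?thesis by simp
qed

text \<open>
  Synthetic division of \<open>\<Sum>j. x j * s ^ (n - j)\<close> by \<open>s - c\<close>, for a root \<open>c\<close> of \<open>p\<close>, splits
  a companion system into the scalar equation of the remainder, decoupled from the
  other variables, and the companion system of \<open>p div (s - c)\<close>, which the remainder enters as an input.
\<close>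

lemma horner_partial_companion_solution:
  fixes q :: "complex poly"
  assumes sol: "companion_solution ([:- c, 1:] * q) L T x f"
    and q: "lead_coeff q = 1" and j: "j \<le> Suc (degree q)" and t: "t \<in> {0..T}"
  defines "b \<equiv> \<lambda>j s. horner_partial c (\<lambda>i. if i \<le> Suc (degree q) then x i s else 0) j"
  shows "((\<lambda>s. of_real L * (b (Suc j) s - coeff (reflect_poly q) j * b 1 s)
            + horner_partial c (\<lambda>i. f i s) j) has_integral (b j t - b j 0)) {0..t}"
  using j
proof (induction j)
  case 0
  \<comment> \<open>Index 0 works because \<open>q\<close> is monic:
    \<open>coeff (reflect_poly q) 0 = 1\<close>, and the integrand is \<open>b 1 s - b 1 s\<close>
    up to the factor \<open>L\<close>.\<close>
  then show ?case using q by (simp add: b_def)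
next
  case (Suc j)
  define g where "g j s = horner_partial c (\<lambda>i. f i s) j" for j s
  have deg: "degree ([:- c, 1:] * q) = Suc (degree q)"
    using q by (subst degree_mult_eq) auto
  \<comment> \<open>The value 0 beyond the degree stands for the missing successor of the last
    variable, so one recursion covers all \<open>j\<close>.\<close>
  define x' where "x' j s = (if j \<le> Suc (degree q) then x j s else 0)" for j s
  have b: "b (Suc j) s = x' (Suc j) s + c * b j s" for j s
    by (simp add: b_def x'_def)
  have g: "g (Suc j) s = f (Suc j) s + c * g j s" for j s
    by (simp add: g_def)
  have b1: "b 1 s = x 1 s" for s by (simp add: b_def)
  have "((\<lambda>s. of_real L * (x' (Suc (Suc j)) s - coeff (reflect_poly ([:- c, 1:] * q)) (Suc j) * x 1 s) + f (Suc j) s)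
          has_integral (x' (Suc j) t - x' (Suc j) 0)) {0..t}"
    using sol Suc.prems t unfolding companion_solution_def deg x'_def
    by (auto dest!: bspec[of _ _ "Suc j"] bspec[of _ _ t] simp: Suc_le_eq simp del: mult_pCons_left)
  moreover have "((\<lambda>s. c * (of_real L * (b (Suc j) s - coeff (reflect_poly q) j * b 1 s) + g j s))
      has_integral c * (b j t - b j 0)) {0..t}"
    unfolding g_def using Suc by (intro has_integral_mult_right) auto
  ultimately have "((\<lambda>s. of_real L * (x' (Suc (Suc j)) s - coeff (reflect_poly ([:- c, 1:] * q)) (Suc j) * x 1 s) + f (Suc j) s
      + c * (of_real L * (b (Suc j) s - coeff (reflect_poly q) j * b 1 s) + g j s))
      has_integral (x' (Suc j) t - x' (Suc j) 0 + c * (b j t - b j 0))) {0..t}"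
    by (rule has_integral_add)
  \<comment> \<open>The terms with \<open>c * coeff (reflect_poly q) j\<close> cancel, by the
    recursion between the coefficients of \<open>p\<close> and of \<open>q\<close>.\<close>
  moreover have "of_real L * (x' (Suc (Suc j)) s - coeff (reflect_poly ([:- c, 1:] * q)) (Suc j) * x 1 s) + f (Suc j) s
      + c * (of_real L * (b (Suc j) s - coeff (reflect_poly q) j * b 1 s) + g j s)
      = of_real L * (b (Suc (Suc j)) s - coeff (reflect_poly q) (Suc j) * b 1 s) + g (Suc j) s" for s
    unfolding b[of "Suc j"] g coeff_reflect_poly_linear_mult b1 by (simp add: algebra_simps)
  moreover have "x' (Suc j) t - x' (Suc j) 0 + c * (b j t - b j 0) = b (Suc j) t - b (Suc j) 0"
    unfolding b by (simp add: algebra_simps)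
  ultimately show ?case unfolding g_def[symmetric] by (simp only:)
qed

text \<open>\<open>C\<close> does not depend on \<open>L\<close>: a faster system divides the effect
  of inputs by \<open>L\<close> without enlarging that of the initial state. Inputs of the form
  \<open>F0 + F1 * exp (- t)\<close> are the class that passes along a cascade.\<close>

definition companion_gain :: "complex poly \<Rightarrow> real \<Rightarrow> real \<Rightarrow> bool" where
  "companion_gain p C a \<longleftrightarrow> (\<forall>L T E F0 F1 x f.
    a \<le> L \<longrightarrow> 0 \<le> E \<longrightarrow> 0 \<le> F0 \<longrightarrow> 0 \<le> F1 \<longrightarrow> companion_solution p L T x f \<longrightarrow>
    (\<forall>j\<in>{1..degree p}. norm (x j 0) \<le> E) \<longrightarrow>
    (\<forall>j\<in>{1..degree p}. \<forall>t\<in>{0..T}. norm (f j t) \<le> F0 + F1 * exp (- t)) \<longrightarrow>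
    (\<forall>j\<in>{1..degree p}. \<forall>t\<in>{0..T}. norm (x j t) \<le> C * (E * exp (- t) + (F0 + F1 * exp (- t)) / L)))"

text \<open>Induction on the degree, splitting off a root \<open>c\<close>: the remainder obeys a
  stable scalar equation, and the variables of the quotient form a smaller companion system driven
  by it.\<close>

lemma companion_gain_exists:
  fixes p :: "complex poly"
  assumes "lead_coeff p = 1" "\<And>s. poly p s = 0 \<Longrightarrow> Re s < 0"
  shows "\<exists>C a. 0 < C \<and> 0 < a \<and> companion_gain p C a"
  using assms
proof (induction "degree p" arbitrary: p)
  case 0
  show ?case by (intro exI[of _ 1]) (use 0 in \<open>auto simp: companion_gain_def\<close>)
next
  case (Suc n p)
  have "\<not> constant (poly p)" using Suc.hyps(2) by (simp add: constant_degree)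
  then obtain c where c: "poly p c = 0" using fundamental_theorem_of_algebra by blast
  then obtain q where p: "p = [:- c, 1:] * q" unfolding poly_eq_0_iff_dvd by (auto elim: dvdE)
  define \<alpha> where "\<alpha> = - Re c"
  have \<alpha>: "\<alpha> > 0" using Suc.prems(2)[OF c] by (simp add: \<alpha>_def)
  have lq: "lead_coeff q = 1" using Suc.prems(1) unfolding p by (simp add: lead_coeff_mult del: mult_pCons_left)
  then have dp: "degree p = Suc (degree q)" unfolding p by (subst degree_mult_eq) auto
  with Suc.hyps(2) have n: "n = degree q" by simp
  have "\<And>s. poly q s = 0 \<Longrightarrow> Re s < 0" using Suc.prems(2) unfolding p by simp
  from Suc.hyps(1)[OF n lq this] obtain C a where C: "0 < C" and a: "0 < a" and "companion_gain q C a"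
    by auto
  note IH = this(3)[unfolded companion_gain_def, rule_format]
  \<comment> \<open>Cost of passing from \<open>x\<close> and \<open>f\<close> to their Horner
    combinations.\<close>
  define M where "M = (1 + norm c) ^ Suc n"
  have M: "M \<ge> 1" unfolding M_def by (intro one_le_power) simp
  \<comment> \<open>\<open>C1\<close> is the gain of the remainder, with
    \<open>2 * M / \<alpha>\<close> from \<open>scalar_bound\<close>. \<open>C2\<close> serves the
    quotient variables too, whose inputs carry the remainder with weight \<open>C1\<close>.\<close>
  define C1 where "C1 = M + 2 * M / \<alpha>"
  have C1: "C1 > 0" "2 * M / \<alpha> \<le> C1" "M \<le> C1" using M \<alpha> by (auto simp: C1_def intro: add_pos_nonneg)
  define C2 where "C2 = C * (M + C1) + C1"
  have C2: "C2 > 0" "C1 \<le> C2" "C * (M + C1) \<le> C2" using C1 C M by (auto simp: C2_def intro: add_nonneg_pos)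
  show ?case
    unfolding companion_gain_def
  \<comment> \<open>The threshold \<open>2 / \<alpha>\<close> ensures
    \<open>Re (L * c) <= - 2\<close>. The factor \<open>1 + norm c\<close> comes from recovering
    \<open>x (Suc i) = b (Suc i) - c * b i\<close>.\<close>
  proof (rule exI[of _ "(1 + norm c) * C2"], rule exI[of _ "max a (2 / \<alpha>)"], intro conjI allI impI ballI)
    show "0 < (1 + norm c) * C2" using C2 by (simp add: add_pos_nonneg)
    show "0 < max a (2 / \<alpha>)" using a by simp
    fix L T E F0 F1 :: real and x f j t
    assume L: "max a (2 / \<alpha>) \<le> L" and E: "0 \<le> E" and F: "0 \<le> F0" "0 \<le> F1"
      and sol: "companion_solution p L T x f"
      and bd: "\<forall>j\<in>{1..degree p}. norm (x j 0) \<le> E"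
        "\<forall>j\<in>{1..degree p}. \<forall>t\<in>{0..T}. norm (f j t) \<le> F0 + F1 * exp (- t)"
      and j: "j \<in> {1..degree p}" and t: "t \<in> {0..T}"
    have L0: "L > 0" using L a by linarith
    have "2 / \<alpha> \<le> L" using L by simp
    then have L2: "\<alpha> * L \<ge> 2" using \<alpha> by (simp add: field_simps)
    define b where "b j s = horner_partial c (\<lambda>i. if i \<le> Suc (degree q) then x i s else 0) j" for j s
    define g where "g j s = horner_partial c (\<lambda>i. f i s) j" for j s
    have b_eq: "((\<lambda>s. of_real L * (b (Suc j) s - coeff (reflect_poly q) j * b 1 s)
            + g j s) has_integral (b j t - b j 0)) {0..t}" if "j \<le> Suc n" "t \<in> {0..T}" for j t
      using horner_partial_companion_solution[OF sol[unfolded p] lq, of j t] that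
      by (simp add: b_def[abs_def] g_def n)
    define Q where "Q t = E * exp (- t) + (F0 + F1 * exp (- t)) / L" for t
    have pow: "(1 + norm c) ^ j \<le> M" if "j \<le> Suc n" for j
      unfolding M_def using that by (intro power_increasing) auto
    have b0: "norm (b j 0) \<le> M * E" if "j \<le> Suc n" for j
    proof -
      have "norm (b j 0) \<le> (1 + norm c) ^ j * E"
        unfolding b_def using bd that n E dp by (intro norm_horner_partial_le) auto
      also have "\<dots> \<le> M * E" using E pow[OF that] by (rule mult_right_mono[rotated])
      finally show ?thesis .
    qed
    have gb: "norm (g j s) \<le> M * F0 + M * F1 * exp (- s)" if "j \<le> Suc n" "s \<in> {0..T}" for j s
    proof -
      have "norm (g j s) \<le> (1 + norm c) ^ j * (F0 + F1 * exp (- s))"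
        unfolding g_def using bd that n F dp by (intro norm_horner_partial_le) auto
      also have "\<dots> \<le> M * (F0 + F1 * exp (- s))" using F pow[OF that(1)] by (intro mult_right_mono) auto
      finally show ?thesis by (simp add: algebra_simps)
    qed
    have bn: "norm (b (Suc n) t) \<le> C1 * Q t" if t: "t \<in> {0..T}" for t
    proof -
      define e where "e = exp (- t)"
      have e: "e > 0" by (simp add: e_def)
      \<comment> \<open>At the last index \<open>x\<close> is cut off and \<open>q\<close> has no
        coefficient left, which leaves a scalar equation with coefficient
        \<open>L * c\<close>.\<close>
      have "b (Suc (Suc n)) s = c * b (Suc n) s" for s by (simp add: b_def n)
      moreover have "coeff (reflect_poly q) (Suc n) = 0" by (simp add: coeff_reflect_poly n)
      ultimately have "((\<lambda>s. (of_real L * c) * b (Suc n) s + g (Suc n) s) has_integral (b (Suc n) t - b (Suc n) 0)) {0..t}"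
        if "t \<in> {0..T}" for t
        using b_eq[of "Suc n" t] that by (simp add: mult.assoc)
      then have "norm (b (Suc n) t) \<le> norm (b (Suc n) 0) * e + 2 * (M * F0 + M * F1 * e) / - Re (of_real L * c)"
        unfolding e_def using gb[of "Suc n"] F M L2 t by (intro scalar_bound) (auto simp: \<alpha>_def mult.commute)
      also have "norm (b (Suc n) 0) * e \<le> M * E * e"
        using b0[of "Suc n"] e by (intro mult_right_mono) auto
      also have "2 * (M * F0 + M * F1 * e) / - Re (of_real L * c) = 2 * M / \<alpha> * ((F0 + F1 * e) / L)"
        using L0 \<alpha> by (simp add: \<alpha>_def field_simps)
      also have "M * E * e + 2 * M / \<alpha> * ((F0 + F1 * e) / L) \<le> C1 * (E * e) + C1 * ((F0 + F1 * e) / L)"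
        unfolding mult.assoc[of M] using C1 E e F L0 by (intro add_mono mult_right_mono) auto
      finally show ?thesis by (simp add: Q_def e_def algebra_simps)
    qed
    have bj: "norm (b j t) \<le> C2 * Q t" if j: "j \<le> Suc n" and t: "t \<in> {0..T}" for j t
    proof -
      define e where "e = exp (- t)"
      have Q: "Q t \<ge> 0" using E F L0 by (simp add: Q_def)
      consider "j = 0" | "j = Suc n" | "j \<in> {1..n}" using j by force
      then show ?thesis
      proof cases
        case 1 then show ?thesis using C2 Q by (simp add: b_def)
      next
        case 2 then show ?thesis
          using bn[OF t] mult_right_mono[OF C2(2) Q] by simp
      next
        case 3
        \<comment> \<open>The remainder enters the last quotient equation with a factor
          \<open>L\<close>, which the gain of the quotient divides out again. Its own transient is
          what makes decaying inputs necessary in the induction.\<close>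
        define h where "h j s = g j s + (if j = n then of_real L * b (Suc n) s else 0)" for j s
        have "companion_solution q L T b h"
          unfolding companion_solution_def
        proof (intro ballI)
          fix j t assume j: "j \<in> {1..degree q}" and t: "t \<in> {0..T}"
          have "of_real L * ((if j < degree q then b (Suc j) s else 0) - coeff (reflect_poly q) j * b 1 s) + h j s
            = of_real L * (b (Suc j) s - coeff (reflect_poly q) j * b 1 s) + g j s" for s
            using j by (auto simp: h_def n algebra_simps)
          then show "((\<lambda>s. of_real L * ((if j < degree q then b (Suc j) s else 0) - coeff (reflect_poly q) j * b 1 s) + h j s)
             has_integral (b j t - b j 0)) {0..t}"
            using b_eq[of j t] j t n by simp
        qed
        moreover have "norm (h j s) \<le> (M + C1) * F0 + ((M + C1) * F1 + C1 * (L * E)) * exp (- s)"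
          if j: "j \<in> {1..degree q}" and s: "s \<in> {0..T}" for j s
        proof -
          have "norm (of_real L * b (Suc n) s) \<le> L * (C1 * Q s)"
            using bn[OF s] L0 by (simp add: norm_mult)
          also have "\<dots> = C1 * (L * E * exp (- s) + (F0 + F1 * exp (- s)))"
            using L0 by (simp add: Q_def field_simps)
          finally have 1: "norm (if j = n then of_real L * b (Suc n) s else 0) \<le> C1 * (L * E * exp (- s) + (F0 + F1 * exp (- s)))"
            using C1 L0 E F by auto
          have "norm (h j s) \<le> M * F0 + M * F1 * exp (- s) + C1 * (L * E * exp (- s) + (F0 + F1 * exp (- s)))"
            unfolding h_def using j n s by (intro order.trans[OF norm_triangle_ineq] add_mono gb 1) auto
          then show ?thesis by (simp add: algebra_simps)
        qed
        moreover have "norm (b j 0) \<le> M * E" if "j \<in> {1..degree q}" for j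
          using b0[of j] that n by auto
        ultimately have "norm (b j t) \<le> C * (M * E * e + ((M + C1) * F0 + ((M + C1) * F1 + C1 * (L * E)) * e) / L)"
          unfolding e_def using L E F M C1 L0 3 n t by (intro IH[where f = h and T = T]) auto
        also have "M * E * e + ((M + C1) * F0 + ((M + C1) * F1 + C1 * (L * E)) * e) / L
           = (M + C1) * Q t"
          using L0 by (simp add: Q_def e_def field_simps)
        also have "C * ((M + C1) * Q t) \<le> C2 * Q t"
          using mult_right_mono[OF C2(3) Q] by (simp add: mult.assoc)
        finally show ?thesis .
      qed
    qed
    from j obtain i where i: "j = Suc i" "i \<le> n" using dp n by (cases j) auto
    have "b (Suc i) t = x (Suc i) t + c * b i t" using i n by (simp add: b_def)
    then have "x j t = b (Suc i) t - c * b i t" using i by simp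
    also have "norm \<dots> \<le> C2 * Q t + norm c * (C2 * Q t)"
      using bj[of "Suc i" t] bj[of i t] i t
      by (intro order.trans[OF norm_triangle_ineq4] add_mono) (auto simp: norm_mult intro!: mult_left_mono)
    finally show "norm (x j t) \<le> (1 + norm c) * C2 * (E * exp (- t) + (F0 + F1 * exp (- t)) / L)"
      unfolding Q_def[symmetric] by (simp add: algebra_simps)
  qed
qed

section \<open>High gain blocks\<close>

lemma coeff_gain_poly: "coeff (gain_poly k i) n = (if n = i then 1 else if n < i then k i (i - n) else 0)"
proof -
  have "(\<Sum>j = 1..i. if i - j = n then k i j else 0) = (if n < i then k i (i - n) else 0)"
  proof (cases "n < i")
    case True
    have "(\<Sum>j = 1..i. if i - j = n then k i j else 0) = (\<Sum>j = 1..i. if j = i - n then k i j else 0)"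
      using True by (intro sum.cong) auto
    then show ?thesis using True by (simp add: sum.delta)
  qed (auto intro!: sum.neutral)
  then show ?thesis by (auto simp: gain_poly_def coeff_sum)
qed

lemma degree_gain_poly: "degree (gain_poly k i) = i"
  by (rule antisym[OF degree_le le_degree]) (auto simp: coeff_gain_poly)

definition block_solution ::
    "(nat \<Rightarrow> nat \<Rightarrow> real) \<Rightarrow> nat \<Rightarrow> real \<Rightarrow> real \<Rightarrow> (nat \<Rightarrow> real \<Rightarrow> real) \<Rightarrow> (nat \<Rightarrow> real \<Rightarrow> real) \<Rightarrow> bool" where
  "block_solution k i L T e f \<longleftrightarrow>
     (\<forall>j\<in>{1..i}. \<forall>t\<in>{0..T}.
        ((\<lambda>s. (if j < i then e (Suc j) s else 0) - L ^ j * k i j * e 1 s + f j s)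
          has_integral (e j t - e j 0)) {0..t})"

text \<open>The usual high gain scaling of \<open>e j\<close> by \<open>L ^ (i - j)\<close> makes
  \<open>L\<close> a common factor of the integrator chain and of the gains
  \<open>L ^ j * k i j\<close>. Complex values allow for complex roots.\<close>

lemma companion_solution_of_block_solution:
  assumes "block_solution k i L T e f"
  shows "companion_solution (map_poly of_real (gain_poly k i)) L T
    (\<lambda>j s. of_real (L ^ (i - j) * e j s)) (\<lambda>j s. of_real (L ^ (i - j) * f j s))"
proof -
  define p where "p = map_poly complex_of_real (gain_poly k i)"
  have deg: "degree p = i"
    unfolding p_def by (simp add: degree_map_poly degree_gain_poly)
  show ?thesis
    unfolding companion_solution_def p_def[symmetric] deg
  proof (intro ballI)
    fix j t assume j: "j \<in> {1..i}" and t: "t \<in> {0..T}"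
    have k: "coeff (reflect_poly p) j = of_real (k i j)"
      using j by (auto simp: coeff_reflect_poly deg) (auto simp: p_def coeff_map_poly coeff_gain_poly)
    have "L ^ (i - j) * (if j < i then X else 0) = L * (if j < i then L ^ (i - Suc j) * X else 0)" for X
    proof -
      have "L ^ (i - j) = L * L ^ (i - Suc j)" if "j < i"
        using that by (simp flip: power_Suc add: Suc_diff_Suc)
      then show ?thesis by simp
    qed
    moreover have "L ^ (i - j) * (L ^ j * k i j * X) = L * (k i j * (L ^ (i - 1) * X))" for X
    proof -
      have "L ^ (i - j) * L ^ j = L * L ^ (i - 1)"
        using j by (simp flip: power_add power_Suc)
      then have "L ^ (i - j) * L ^ j * (k i j * X) = L * L ^ (i - 1) * (k i j * X)" by simp
      then show ?thesis by (simp only: mult_ac)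
    qed
    ultimately have "L ^ (i - j) * ((if j < i then e (Suc j) s else 0) - L ^ j * k i j * e 1 s + f j s)
      = L * ((if j < i then L ^ (i - Suc j) * e (Suc j) s else 0) - k i j * (L ^ (i - 1) * e 1 s)) + L ^ (i - j) * f j s" for s
      by (simp only: distrib_left right_diff_distrib)
    moreover have "of_real (if j < i then X else 0) = (if j < i then complex_of_real X else 0)" for X
      by simp
    ultimately have "complex_of_real (L ^ (i - j) * ((if j < i then e (Suc j) s else 0) - L ^ j * k i j * e 1 s + f j s))
      = of_real L * ((if j < i then of_real (L ^ (i - Suc j) * e (Suc j) s) else 0)
          - coeff (reflect_poly p) j * of_real (L ^ (i - 1) * e 1 s)) + of_real (L ^ (i - j) * f j s)" for s
      unfolding k by (simp only: of_real_mult of_real_add of_real_diff)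
    moreover have I: "((\<lambda>s. (if j < i then e (Suc j) s else 0) - L ^ j * k i j * e 1 s + f j s)
       has_integral (e j t - e j 0)) {0..t}"
      using assms j t unfolding block_solution_def by blast
    have "((\<lambda>s. complex_of_real (L ^ (i - j) * ((if j < i then e (Suc j) s else 0) - L ^ j * k i j * e 1 s + f j s)))
      has_integral complex_of_real (L ^ (i - j) * (e j t - e j 0))) {0..t}"
      using has_integral_linear[OF has_integral_mult_right[OF I] bounded_linear_of_real] unfolding o_def .
    ultimately show "((\<lambda>s. of_real L * ((if j < i then of_real (L ^ (i - Suc j) * e (Suc j) s) else 0)
          - coeff (reflect_poly p) j * of_real (L ^ (i - 1) * e 1 s)) + of_real (L ^ (i - j) * f j s))
       has_integral of_real (L ^ (i - j) * e j t) - of_real (L ^ (i - j) * e j 0)) {0..t}"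
      by (simp only: right_diff_distrib of_real_diff)
  qed
qed

text \<open>Unscaled form of \<open>companion_gain\<close>. The initial error pays the peaking
  factor \<open>L ^ i\<close>; among the inputs only the last has weight 1 and hence an effect of
  order \<open>1 / L\<close>.\<close>

definition block_gain :: "(nat \<Rightarrow> nat \<Rightarrow> real) \<Rightarrow> nat \<Rightarrow> real \<Rightarrow> real \<Rightarrow> bool" where
  "block_gain k i C a \<longleftrightarrow> (\<forall>L T E F0 F1 e f.
    a \<le> L \<longrightarrow> 0 \<le> E \<longrightarrow> 0 \<le> F0 \<longrightarrow> 0 \<le> F1 \<longrightarrow> block_solution k i L T e f \<longrightarrow>
    (\<forall>j\<in>{1..i}. \<bar>e j 0\<bar> \<le> E) \<longrightarrow>
    (\<forall>j\<in>{1..i}. \<forall>t\<in>{0..T}. L ^ (i - j) * \<bar>f j t\<bar> \<le> F0 + F1 * exp (- t)) \<longrightarrow>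
    (\<forall>j\<in>{1..i}. \<forall>t\<in>{0..T}. \<bar>e j t\<bar> \<le> C * (L ^ i * E * exp (- t) + (F0 + F1 * exp (- t)) / L)))"

lemma block_gain_exists:
  assumes "hurwitz (gain_poly k i)"
  shows "\<exists>C a. 0 < C \<and> 1 \<le> a \<and> block_gain k i C a"
proof -
  define p where "p = map_poly complex_of_real (gain_poly k i)"
  have deg: "degree p = i"
    unfolding p_def by (simp add: degree_map_poly degree_gain_poly)
  then have "lead_coeff p = 1"
    by (simp add: p_def coeff_map_poly coeff_gain_poly)
  then obtain C a where C: "0 < C" "companion_gain p C a"
    using companion_gain_exists[of p] assms unfolding hurwitz_def p_def[symmetric] by blast
  \<comment> \<open>With \<open>L >= 1\<close> undoing the scaling costs nothing, and
    \<open>L ^ (i - j) <= L ^ i\<close> bounds the scaled initial error.\<close>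
  have "block_gain k i C (max 1 a)"
    unfolding block_gain_def
  proof (intro allI impI ballI)
    fix L T E F0 F1 :: real and e f j t
    assume L: "max 1 a \<le> L" and E: "0 \<le> E" and F: "0 \<le> F0" "0 \<le> F1"
      and sol: "block_solution k i L T e f"
      and e0: "\<forall>j\<in>{1..i}. \<bar>e j 0\<bar> \<le> E"
      and f: "\<forall>j\<in>{1..i}. \<forall>t\<in>{0..T}. L ^ (i - j) * \<bar>f j t\<bar> \<le> F0 + F1 * exp (- t)"
      and j: "j \<in> {1..i}" and t: "t \<in> {0..T}"
    have L1: "L \<ge> 1" using L by simp
    have nrm: "norm (complex_of_real (L ^ n * y)) = L ^ n * \<bar>y\<bar>" for n y
      using L1 by (simp add: norm_mult norm_power)
    have "L ^ (i - j) * \<bar>e j 0\<bar> \<le> L ^ i * E" if "j \<in> {1..i}" for j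
      using L1 e0 that by (intro mult_mono power_increasing) auto
    then have "norm (complex_of_real (L ^ (i - j) * e j t)) \<le> C * (L ^ i * E * exp (- t) + (F0 + F1 * exp (- t)) / L)"
      using L1 L E F f j t companion_solution_of_block_solution[OF sol]
      by (intro C(2)[unfolded companion_gain_def, rule_format, where x = "\<lambda>j s. of_real (L ^ (i - j) * e j s)"
            and f = "\<lambda>j s. of_real (L ^ (i - j) * f j s)" and T = T])
        (simp_all only: nrm deg p_def[symmetric], auto)
    moreover have "\<bar>e j t\<bar> \<le> L ^ (i - j) * \<bar>e j t\<bar>"
      using mult_right_mono[of 1 "L ^ (i - j)" "\<bar>e j t\<bar>"] L1 by simp
    ultimately show "\<bar>e j t\<bar> \<le> C * (L ^ i * E * exp (- t) + (F0 + F1 * exp (- t)) / L)"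
      unfolding nrm by linarith
  qed
  then show ?thesis using C(1) by (intro exI[of _ C] exI[of _ "max 1 a"]) auto
qed

section \<open>Star-shaped class K functions\<close>

text \<open>The second condition says that \<open>q x / x\<close> is nondecreasing for
  \<open>x > 0\<close>. Unlike a Lipschitz bound it allows any growth, and sums, positive multiples
  and compositions preserve it.\<close>

definition star_K :: "(real \<Rightarrow> real) \<Rightarrow> bool" where
  "star_K q \<longleftrightarrow> class_K q \<and> (\<forall>x\<ge>0. \<forall>c\<in>{0..1}. q (c * x) \<le> c * q x)"

lemma class_K_mono: "class_K q \<Longrightarrow> 0 \<le> x \<Longrightarrow> x \<le> y \<Longrightarrow> q x \<le> q y"
  by (cases "x = y") (auto simp: class_K_def strict_mono_on_def less_imp_le)

lemma class_K_nonneg: "class_K q \<Longrightarrow> 0 \<le> x \<Longrightarrow> 0 \<le> q x"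
  using class_K_mono[of q 0 x] by (simp add: class_K_def)

lemma class_K_pos: "class_K q \<Longrightarrow> 0 < x \<Longrightarrow> 0 < q x"
  using strict_mono_onD[of "{0..}" q 0 x] by (simp add: class_K_def)

lemma star_K_imp_class_K: "star_K q \<Longrightarrow> class_K q"
  by (simp add: star_K_def)

lemma star_K_mono: "star_K q \<Longrightarrow> 0 \<le> x \<Longrightarrow> x \<le> y \<Longrightarrow> q x \<le> q y"
  by (rule class_K_mono[OF star_K_imp_class_K])

lemma star_K_nonneg: "star_K q \<Longrightarrow> 0 \<le> x \<Longrightarrow> 0 \<le> q x"
  by (rule class_K_nonneg[OF star_K_imp_class_K])

lemma star_K_scale_le: "star_K q \<Longrightarrow> 0 \<le> x \<Longrightarrow> 0 \<le> c \<Longrightarrow> c \<le> 1 \<Longrightarrow> q (c * x) \<le> c * q x"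
  by (simp add: star_K_def)

lemma star_K_id: "star_K (\<lambda>x. x)"
  by (auto simp: star_K_def class_K_def strict_mono_on_def)

lemma star_K_add:
  assumes p: "star_K p" and q: "star_K q"
  shows "star_K (\<lambda>x. p x + q x)"
proof -
  have "p (c * x) + q (c * x) \<le> c * (p x + q x)" if "x \<ge> 0" "c \<in> {0..1}" for c x
    using p q that unfolding star_K_def by (auto simp: distrib_left intro!: add_mono)
  moreover have "strict_mono_on {0..} (\<lambda>x. p x + q x)"
    using p q unfolding star_K_def class_K_def strict_mono_on_def by (auto intro!: add_strict_mono)
  ultimately show ?thesis
    using p q by (auto simp: star_K_def class_K_def intro: continuous_intros)
qed

lemma star_K_cmult:
  assumes q: "star_K q" and a: "a > 0"
  shows "star_K (\<lambda>x. a * q x)"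
proof -
  have "a * q (c * x) \<le> c * (a * q x)" if "x \<ge> 0" "c \<in> {0..1}" for c x
  proof -
    have "q (c * x) \<le> c * q x" using q that unfolding star_K_def by blast
    then show ?thesis using a by (simp add: mult.left_commute)
  qed
  moreover have "strict_mono_on {0..} (\<lambda>x. a * q x)"
    using q a unfolding star_K_def class_K_def strict_mono_on_def by auto
  ultimately show ?thesis
    using q by (auto simp: star_K_def class_K_def intro: continuous_intros)
qed

lemma star_K_compose:
  assumes p: "star_K p" and q: "star_K q"
  shows "star_K (\<lambda>x. p (q x))"
proof -
  have "p (q (c * x)) \<le> c * p (q x)" if "x \<ge> 0" "c \<in> {0..1}" for c x
  proof -
    have "p (q (c * x)) \<le> p (c * q x)"
      using that q by (intro star_K_mono[OF p] star_K_nonneg[OF q]) (auto simp: star_K_def)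
    also have "\<dots> \<le> c * p (q x)"
      using p that star_K_nonneg[OF q, of x] by (auto simp: star_K_def)
    finally show ?thesis .
  qed
  moreover have "continuous_on {0..} (\<lambda>x. p (q x))"
  proof (rule continuous_on_compose2[of "{0..}" p])
    show "continuous_on {0..} p" "continuous_on {0..} q"
      using p q by (auto simp: star_K_def class_K_def)
    show "q ` {0..} \<subseteq> {0..}" using star_K_nonneg[OF q] by auto
  qed
  moreover have "strict_mono_on {0..} (\<lambda>x. p (q x))"
    using p q star_K_nonneg[OF q] by (auto simp: star_K_def class_K_def strict_mono_on_def)
  ultimately show ?thesis
    using p q by (auto simp: star_K_def class_K_def)
qed

text \<open>Scaling \<open>x >= 1\<close> down to 1 gives the linear lower bound
  \<open>q 1 * x <= q x\<close>.\<close>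

lemma star_K_imp_class_K_inf:
  assumes q: "star_K q"
  shows "class_K_inf q"
proof -
  have q1: "q 1 > 0"
    using class_K_pos[OF star_K_imp_class_K[OF q]] by simp
  have "q 1 * x \<le> q x" if "x \<ge> 1" for x
  proof -
    have "q (1 / x * x) \<le> 1 / x * q x" using that by (intro star_K_scale_le[OF q]) auto
    then show ?thesis using that by (simp add: field_simps)
  qed
  then have "eventually (\<lambda>x. q 1 * x \<le> q x) at_top"
    using eventually_ge_at_top[of 1] by (rule eventually_mono[rotated])
  moreover have "filterlim (\<lambda>x. q 1 * x) at_top at_top"
    using q1 by (intro filterlim_tendsto_pos_mult_at_top[OF tendsto_const]) (auto simp: filterlim_ident)
  ultimately show ?thesis
    using q filterlim_at_top_mono by (auto simp: class_K_inf_def star_K_def)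
qed

text \<open>On \<open>{0..1}\<close> the graph of \<open>q\<close> lies below the chord
  \<open>x * q 1\<close>.\<close>

lemma star_K_arbitrarily_small:
  assumes q: "star_K q" and \<eta>: "\<eta> > 0"
  shows "\<exists>\<delta>>0. q \<delta> \<le> \<eta>"
proof -
  have q1: "q 1 > 0"
    using class_K_pos[OF star_K_imp_class_K[OF q]] by simp
  define \<delta> where "\<delta> = min 1 (\<eta> / q 1)"
  have d: "\<delta> > 0" "\<delta> \<le> 1" using q1 \<eta> by (auto simp: \<delta>_def)
  have "q (\<delta> * 1) \<le> \<delta> * q 1" using d by (intro star_K_scale_le[OF q]) auto
  also have "\<dots> \<le> \<eta> / q 1 * q 1" using q1 by (intro mult_right_mono) (auto simp: \<delta>_def)
  finally show ?thesis using d q1 by auto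
qed

text \<open>Replaces subadditivity, which star-shaped functions lack in general: a sum is at most
  three times its largest term.\<close>

lemma star_K_add3_le:
  assumes q: "star_K q" and "0 \<le> a" "0 \<le> b" "0 \<le> c"
  shows "q (a + b + c) \<le> q (3 * a) + q (3 * b) + q (3 * c)"
proof -
  have "q (a + b + c) \<le> q (3 * max a (max b c))"
    using assms by (intro star_K_mono[OF q]) auto
  moreover have "q (3 * a) \<ge> 0" "q (3 * b) \<ge> 0" "q (3 * c) \<ge> 0"
    using assms by (auto intro: star_K_nonneg)
  moreover consider "max a (max b c) = a" | "max a (max b c) = b" | "max a (max b c) = c"
    by linarith
  ultimately show ?thesis by cases simp_all
qed

text \<open>
  \<open>q x = x * M x\<close> with \<open>M\<close> continuous and nondecreasing; averaging \<open>b\<close> over \<open>{x..x+1}\<close>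
  makes a continuous majorant of the merely monotone \<open>b\<close>.
\<close>

lemma star_K_majorant:
  fixes b :: "real \<Rightarrow> real"
  assumes b: "mono_on {0..} b" "\<And>x. 0 \<le> b x" and \<delta>: "\<delta> > 0"
  shows "\<exists>q. star_K q \<and> (\<forall>x\<ge>\<delta>. b x \<le> q x)"
proof -
  \<comment> \<open>Integrating from 0 makes \<open>I\<close> monotone because \<open>b\<close> is
    nonnegative, while the last unit interval alone contributes at least \<open>b x\<close>.\<close>
  define I where "I x = integral {0..x + 1} b" for x
  have int: "b integrable_on {s..t}" if "0 \<le> s" for s t
    using b(1) that by (intro integrable_on_mono_on mono_on_subset[OF b(1)]) auto
  have I_mono: "I x \<le> I y" if "0 \<le> x" "x \<le> y" for x y
    unfolding I_def using that b int by (intro integral_subset_le) auto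
  have I0: "I x \<ge> 0" for x
    unfolding I_def using b int by (intro integral_nonneg) auto
  have Ib: "b x \<le> I x" if "x \<ge> 0" for x
  proof -
    have "integral {x..x + 1} (\<lambda>_. b x) \<le> integral {x..x + 1} b"
      using that int b(1) by (intro integral_le) (auto simp: mono_on_def)
    also have "\<dots> \<le> I x" unfolding I_def using that b int by (intro integral_subset_le) auto
    finally show ?thesis by simp
  qed
  have cI: "continuous_on {0..} I"
    unfolding continuous_on_eq_continuous_within
  proof
    fix x :: real assume x: "x \<in> {0..}"
    have "continuous_on {0..x + 1} I"
      unfolding I_def
      by (rule continuous_on_compose2[OF indefinite_integral_continuous_1[OF int[of 0 "x + 2"]]])
        (auto intro!: continuous_intros)
    then have "continuous (at x within {0..x + 1}) I"
      using x by (auto simp: continuous_on_eq_continuous_within)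
    moreover have "at x within {0..x + 1} = at x within {0..}"
      by (rule at_within_nhd[where S = "{..<x + 1}"]) auto
    ultimately show "continuous (at x within {0..}) I" by simp
  qed
  \<comment> \<open>The summand 1 gives strict growth. Division by \<delta> makes
    \<open>x * (I x / \<delta>)\<close> exceed \<open>I x\<close> once \<open>x >= \<delta>\<close>;
    near 0 no majorant can be expected, as \<open>q 0 = 0\<close> whereas \<open>b 0\<close> may be
    positive.\<close>
  define q where "q x = x * (1 + I x / \<delta>)" for x
  have I\<delta>: "0 \<le> I x / \<delta>" for x using I0 \<delta> by simp
  have "continuous_on {0..} q"
    unfolding q_def using \<delta> by (intro continuous_intros cI) auto
  moreover have "strict_mono_on {0..} q"
  proof (rule strict_mono_onI)
    fix x y :: real assume xy: "x \<in> {0..}" "y \<in> {0..}" "x < y"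
    have "x * (1 + I x / \<delta>) \<le> x * (1 + I y / \<delta>)"
      using xy I_mono[of x y] \<delta> by (intro mult_left_mono add_left_mono divide_right_mono) auto
    also have "\<dots> < y * (1 + I y / \<delta>)"
      using xy I\<delta>[of y] by (intro mult_strict_right_mono) auto
    finally show "q x < q y" by (simp add: q_def)
  qed
  moreover have "q (c * x) \<le> c * q x" if "x \<ge> 0" "c \<in> {0..1}" for c x
  proof -
    have "c * x \<le> x" using that mult_right_mono[of c 1 x] by simp
    then have "I (c * x) / \<delta> \<le> I x / \<delta>"
      using that \<delta> by (intro divide_right_mono I_mono) auto
    then have "c * x * (1 + I (c * x) / \<delta>) \<le> c * x * (1 + I x / \<delta>)"
      using that by (intro mult_left_mono) auto
    then show ?thesis by (simp add: q_def mult.assoc)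
  qed
  ultimately have "star_K q" by (simp add: star_K_def class_K_def q_def)
  moreover have "b x \<le> q x" if x: "x \<ge> \<delta>" for x
  proof -
    have "b x \<le> I x" using Ib x \<delta> by simp
    also have "\<dots> \<le> x * (I x / \<delta>)"
      using x \<delta> I0[of x] mult_right_mono[of \<delta> x "I x / \<delta>"] by simp
    also have "\<dots> \<le> q x" using x \<delta> by (simp add: q_def algebra_simps)
    finally show ?thesis .
  qed
  ultimately show ?thesis by blast
qed

section \<open>Continuous maps on compact sets: bounds and moduli of continuity\<close>

lemma compact_PiE_Icc:
  fixes r :: real
  shows "compact (J \<rightarrow>\<^sub>E {- r..r})"
proof -
  \<comment> \<open>Extensionality means one-point factors off \<open>J\<close>, so the set is a
    full product of compact sets and Tychonoff's theorem applies.\<close>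
  have "J \<rightarrow>\<^sub>E {- r..r} = (\<Pi>\<^sub>E i\<in>UNIV. if i \<in> J then {- r..r} else {undefined})"
    by (auto simp: PiE_iff extensional_def split: if_splits)
  moreover have "compactin (product_topology (\<lambda>_. euclidean) UNIV)
      (\<Pi>\<^sub>E i\<in>UNIV. if i \<in> J then {- r..r} else {undefined})"
    unfolding compactin_PiE by auto
  ultimately show ?thesis by (simp add: euclidean_product_topology)
qed

lemma L2_set_subset_le: "finite B \<Longrightarrow> A \<subseteq> B \<Longrightarrow> L2_set f A \<le> L2_set f B"
  unfolding L2_set_def by (intro real_sqrt_le_mono sum_mono2) auto

lemma abs_le_L2_set:
  assumes "finite A" "i \<in> A"
  shows "\<bar>f i\<bar> \<le> L2_set f A"
  using member_le_L2_set[OF assms, of "\<lambda>i. \<bar>f i\<bar>"] by (simp add: L2_set_def)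

text \<open>For small increments uniform continuity on a compact set gives \<eta>; for the others
  boundedness suffices. Only \<open>z\<close> is confined to a fixed ball, so \<open>y\<close> is
  handled by the family \<open>K r\<close>, with \<open>r\<close> bounding the increment.\<close>

lemma modulus_of_continuity_star_K:
  fixes \<Phi> :: "'a::euclidean_space \<Rightarrow> (nat \<Rightarrow> real) \<Rightarrow> real"
  assumes cont: "continuous_on (UNIV \<times> (J \<rightarrow>\<^sub>E UNIV)) (\<lambda>(u, x). \<Phi> u x)"
    and J: "finite J" and \<eta>: "\<eta> > 0"
  shows "\<exists>q. star_K q \<and> (\<forall>u z y. norm u \<le> U \<and> L2_set z J \<le> R \<longrightarrow>
    \<bar>\<Phi> u (restrict y J) - \<Phi> u (restrict z J)\<bar> \<le> \<eta> + q (L2_set (\<lambda>l. y l - z l) J))"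
proof -
  define K where "K r = cball (0::'a) U \<times> (J \<rightarrow>\<^sub>E {- R..R}) \<times> (J \<rightarrow>\<^sub>E {- (R + r)..R + r})" for r
  define G where "G = (\<lambda>(u, z, y). \<Phi> u y - \<Phi> u z)"
  define d where "d = (\<lambda>(u::'a, z::nat \<Rightarrow> real, y). L2_set (\<lambda>l. y l - z l) J)"
  have K: "compact (K r)" for r
    unfolding K_def by (intro compact_Times compact_PiE_Icc compact_cball)
  have cG: "continuous_on (K r) G" for r
    unfolding G_def case_prod_unfold
    by (intro continuous_intros continuous_on_compose2[OF cont[unfolded case_prod_unfold], of _ "\<lambda>x. (fst x, fst (snd x))", simplified]
        continuous_on_compose2[OF cont[unfolded case_prod_unfold], of _ "\<lambda>x. (fst x, snd (snd x))", simplified])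
      (auto simp: K_def)
  have cd: "continuous_on S d" for S
    unfolding d_def case_prod_unfold L2_set_def
    by (intro continuous_intros continuous_on_product_then_coordinatewise)
  have in_K: "(u, restrict z J, restrict y J) \<in> K r"
    if "norm u \<le> U" "L2_set z J \<le> R" "L2_set (\<lambda>l. y l - z l) J \<le> r" for u z y r
  proof -
    have "\<bar>z l\<bar> \<le> R" "\<bar>y l - z l\<bar> \<le> r" if "l \<in> J" for l
      using abs_le_L2_set[OF J that, of z] abs_le_L2_set[OF J that, of "\<lambda>l. y l - z l"] \<open>L2_set z J \<le> R\<close>
        \<open>L2_set (\<lambda>l. y l - z l) J \<le> r\<close> by auto
    then have "- R \<le> z l \<and> z l \<le> R \<and> - (R + r) \<le> y l \<and> y l \<le> R + r" if "l \<in> J" for l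
      using that by (smt (verit, best))
    then show ?thesis using that by (auto simp: K_def)
  qed
  \<comment> \<open>On the compact set of pairs violating the tolerance, the distance
    \<open>d\<close> is positive, hence at least some \<delta>.\<close>
  define N where "N = {x \<in> K 1. \<eta> \<le> \<bar>G x\<bar>}"
  have "\<exists>\<delta>>0. \<forall>x\<in>N. \<delta> \<le> d x"
  proof (cases "N = {}")
    case False
    have "compact N"
    proof -
      have "closedin (top_of_set (K 1)) (K 1 \<inter> (\<lambda>x. \<bar>G x\<bar>) -` {\<eta>..})"
        by (intro continuous_closedin_preimage continuous_intros cG)
      then show ?thesis
        using closedin_compact[OF K[of 1]] by (simp add: N_def vimage_def Int_def)
    qed
    then obtain x where x: "x \<in> N" "\<forall>y\<in>N. d x \<le> d y"
      using continuous_attains_inf[OF _ False cd] by blast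
    obtain u z y where uzy: "x = (u, z, y)" by (cases x)
    have "d x \<noteq> 0"
    proof
      assume "d x = 0"
      then have "\<forall>l\<in>J. y l = z l" using J by (simp add: d_def uzy L2_set_eq_0_iff)
      moreover have "y \<in> extensional J" "z \<in> extensional J"
        using x(1) by (auto simp: N_def K_def uzy PiE_iff)
      ultimately have "y = z" by (intro extensionalityI[of y J z]) auto
      then show False using x(1) \<eta> by (auto simp: N_def uzy G_def)
    qed
    then have "d x > 0" by (simp add: d_def uzy less_le)
    then show ?thesis using x(2) by blast
  next
    case True
    then show ?thesis by (intro exI[of _ 1]) simp
  qed
  then obtain \<delta> where \<delta>: "\<delta> > 0" "\<forall>x\<in>N. \<delta> \<le> d x" by blast
  have "\<exists>B. \<forall>x\<in>K r. \<bar>G x\<bar> \<le> B" for r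
    using compact_imp_bounded[OF compact_continuous_image[OF cG K], of r] by (auto simp: bounded_iff)
  then obtain B where B: "\<And>r x. x \<in> K r \<Longrightarrow> \<bar>G x\<bar> \<le> B r" by metis
  \<comment> \<open>Summing the bounds over integer radii makes them monotone in
    \<open>x\<close>.\<close>
  define b where "b (x::real) = (\<Sum>n\<le>nat \<lceil>x\<rceil>. \<bar>B (real n)\<bar>)" for x
  have "mono_on {0..} b"
    unfolding b_def by (intro mono_onI sum_mono2) (auto intro: nat_mono ceiling_mono order.trans)
  moreover have "0 \<le> b x" for x unfolding b_def by (intro sum_nonneg) auto
  \<comment> \<open>Below \<delta> a pair lies outside \<open>N\<close>, below 1 it lies in
    \<open>K 1\<close>; the majorant must take over from the smaller of the two.\<close>
  ultimately obtain q where q: "star_K q" "\<And>x::real. x \<ge> min \<delta> 1 \<Longrightarrow> b x \<le> q x"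
    using star_K_majorant[of b "min \<delta> 1"] \<delta>(1) by auto
  have "\<bar>\<Phi> u (restrict y J) - \<Phi> u (restrict z J)\<bar> \<le> \<eta> + q (L2_set (\<lambda>l. y l - z l) J)"
    if uz: "norm u \<le> U" "L2_set z J \<le> R" for u z y
  proof -
    define e where "e = L2_set (\<lambda>l. y l - z l) J"
    define x where "x = (u, restrict z J, restrict y J)"
    have e: "e \<ge> 0" by (simp add: e_def)
    have dx: "d x = e" by (simp add: d_def x_def e_def cong: L2_set_cong)
    have Gx: "G x = \<Phi> u (restrict y J) - \<Phi> u (restrict z J)" by (simp add: G_def x_def)
    have "\<bar>G x\<bar> \<le> \<eta> + q e"
    proof (cases "e < min \<delta> 1")
      case True
      then have "x \<in> K 1" unfolding x_def using in_K[OF uz, of y 1] by (simp add: e_def)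
      moreover have "x \<notin> N" using True \<delta>(2) dx by auto
      ultimately have "\<bar>G x\<bar> < \<eta>" by (auto simp: N_def)
      then show ?thesis using star_K_nonneg[OF q(1) e] by simp
    next
      case False
      have "e \<le> real (nat \<lceil>e\<rceil>)" by linarith
      then have "x \<in> K (real (nat \<lceil>e\<rceil>))" unfolding x_def using in_K[OF uz, of y] by (simp add: e_def)
      then have "\<bar>G x\<bar> \<le> \<bar>B (real (nat \<lceil>e\<rceil>))\<bar>" using B by fastforce
      also have "\<dots> \<le> b e" unfolding b_def by (rule member_le_sum) auto
      also have "\<dots> \<le> q e" using False by (intro q(2)) linarith
      finally show ?thesis using \<eta> by simp
    qed
    then show ?thesis by (simp add: Gx e_def)
  qed
  then show ?thesis using q(1) by blast
qed

lemma bounded_on_L2_set_ball: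
  fixes \<Phi> :: "'a::euclidean_space \<Rightarrow> (nat \<Rightarrow> real) \<Rightarrow> real"
  assumes cont: "continuous_on (UNIV \<times> (J \<rightarrow>\<^sub>E UNIV)) (\<lambda>(u, x). \<Phi> u x)" and J: "finite J"
  shows "\<exists>B. \<forall>u z. norm u \<le> U \<and> L2_set z J \<le> R \<longrightarrow> \<bar>\<Phi> u (restrict z J)\<bar> \<le> B"
proof -
  define K where "K = cball (0::'a) U \<times> (J \<rightarrow>\<^sub>E {- R..R})"
  have "compact K" unfolding K_def by (intro compact_Times compact_PiE_Icc compact_cball)
  moreover have "continuous_on K (\<lambda>(u, x). \<Phi> u x)"
    by (rule continuous_on_subset[OF cont]) (auto simp: K_def)
  ultimately have "bounded ((\<lambda>(u, x). \<Phi> u x) ` K)"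
    by (intro compact_imp_bounded compact_continuous_image)
  then obtain B where B: "\<And>u x. (u, x) \<in> K \<Longrightarrow> \<bar>\<Phi> u x\<bar> \<le> B"
    by (fastforce simp: bounded_iff)
  have "\<bar>\<Phi> u (restrict z J)\<bar> \<le> B" if "norm u \<le> U" "L2_set z J \<le> R" for u z
  proof (rule B)
    have "\<bar>z l\<bar> \<le> R" if "l \<in> J" for l
      using abs_le_L2_set[OF J that, of z] \<open>L2_set z J \<le> R\<close> by simp
    then have "- R \<le> z l \<and> z l \<le> R" if "l \<in> J" for l using that by (simp add: abs_le_iff minus_le_iff)
    then show "(u, restrict z J) \<in> K" using that by (auto simp: K_def)
  qed
  then show ?thesis by blast
qed

text \<open>Adding the moduli of the components one by one leaves the tolerance at \<eta>, because
  each \<open>j\<close> uses only one of them.\<close>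

lemma Phi_modulus:
  fixes \<Phi> :: "nat \<Rightarrow> real^'p \<Rightarrow> (nat \<Rightarrow> real) \<Rightarrow> real"
  assumes \<Phi>: "Phi_continuous m \<Phi>" and \<eta>: "\<eta> > 0" and n: "n \<le> m"
  shows "\<exists>q. star_K q \<and> (\<forall>j\<in>{1..n}. \<forall>u z y. norm u \<le> U \<and> L2_set z {1..m} \<le> R \<longrightarrow>
    \<bar>\<Phi> j u (restrict y {1..j}) - \<Phi> j u (restrict z {1..j})\<bar> \<le> \<eta> + q (L2_set (\<lambda>l. y l - z l) {1..n}))"
proof -
  have "\<exists>q. star_K q \<and> (\<forall>j\<in>{1..i}. \<forall>u z y. norm u \<le> U \<and> L2_set z {1..m} \<le> R \<longrightarrow>
    \<bar>\<Phi> j u (restrict y {1..j}) - \<Phi> j u (restrict z {1..j})\<bar> \<le> \<eta> + q (L2_set (\<lambda>l. y l - z l) {1..n}))"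
    if "i \<le> n" for i
    using that
  proof (induction i)
    case 0
    show ?case using star_K_id by auto
  next
    case (Suc i)
    then obtain p where p: "star_K p" "\<And>j u z y. j \<in> {1..i} \<Longrightarrow> norm u \<le> U \<Longrightarrow> L2_set z {1..m} \<le> R \<Longrightarrow>
      \<bar>\<Phi> j u (restrict y {1..j}) - \<Phi> j u (restrict z {1..j})\<bar> \<le> \<eta> + p (L2_set (\<lambda>l. y l - z l) {1..n})"
      by (meson Suc_leD)
    have "continuous_on (UNIV \<times> ({1..Suc i} \<rightarrow>\<^sub>E UNIV)) (\<lambda>(u, x). \<Phi> (Suc i) u x)"
      using \<Phi> Suc.prems n unfolding Phi_continuous_def by auto
    from modulus_of_continuity_star_K[OF this _ \<eta>, of U R]
    obtain q where q: "star_K q" "\<And>u z y. norm u \<le> U \<Longrightarrow> L2_set z {1..Suc i} \<le> R \<Longrightarrow>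
      \<bar>\<Phi> (Suc i) u (restrict y {1..Suc i}) - \<Phi> (Suc i) u (restrict z {1..Suc i})\<bar> \<le> \<eta> + q (L2_set (\<lambda>l. y l - z l) {1..Suc i})"
      by auto
    have "\<bar>\<Phi> j u (restrict y {1..j}) - \<Phi> j u (restrict z {1..j})\<bar>
        \<le> \<eta> + (p (L2_set (\<lambda>l. y l - z l) {1..n}) + q (L2_set (\<lambda>l. y l - z l) {1..n}))"
      if "j \<in> {1..Suc i}" and uz: "norm u \<le> U" "L2_set z {1..m} \<le> R" for j u z y
    proof (cases "j = Suc i")
      case True
      have "L2_set z {1..Suc i} \<le> R"
        using L2_set_subset_le[of "{1..m}" "{1..Suc i}" z] Suc.prems n uz by auto
      moreover have "q (L2_set (\<lambda>l. y l - z l) {1..Suc i}) \<le> q (L2_set (\<lambda>l. y l - z l) {1..n})"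
        using Suc.prems by (intro star_K_mono[OF q(1)] L2_set_subset_le) auto
      ultimately show ?thesis
        using q(2)[OF uz(1), of z y] True star_K_nonneg[OF p(1), of "L2_set (\<lambda>l. y l - z l) {1..n}"] by simp
    next
      case False
      then have "j \<in> {1..i}" using that by auto
      from p(2)[OF this uz, of y] show ?thesis
        using star_K_nonneg[OF q(1), of "L2_set (\<lambda>l. y l - z l) {1..n}"] by simp
    qed
    then show ?case
      by (intro exI[of _ "\<lambda>x. p x + q x"] conjI star_K_add[OF p(1) q(1)] ballI allI impI) blast
  qed
  then show ?thesis by blast
qed

text \<open>The drift which block \<open>i\<close> of the observer ignores in its last equation.\<close>

lemma unmodelled_drift_bounded:
  fixes \<Phi> :: "nat \<Rightarrow> real^'p \<Rightarrow> (nat \<Rightarrow> real) \<Rightarrow> real"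
  assumes \<Phi>: "Phi_continuous m \<Phi>" and i: "i \<in> {1..m}"
  shows "\<exists>D\<ge>0. \<forall>u w z. norm u \<le> U \<and> L2_set z {1..m} \<le> R \<longrightarrow> \<bar>system_rhs m \<Phi> u w z i - w i\<bar> \<le> D"
proof -
  have "continuous_on (UNIV \<times> ({1..i} \<rightarrow>\<^sub>E UNIV)) (\<lambda>(u, x). \<Phi> i u x)"
    using \<Phi> i unfolding Phi_continuous_def by auto
  from bounded_on_L2_set_ball[OF this, of U R] obtain B where
    B: "\<And>u z. norm u \<le> U \<Longrightarrow> L2_set z {1..i} \<le> R \<Longrightarrow> \<bar>\<Phi> i u (restrict z {1..i})\<bar> \<le> B"
    by auto
  have "\<bar>system_rhs m \<Phi> u w z i - w i\<bar> \<le> \<bar>R\<bar> + \<bar>B\<bar>" if uz: "norm u \<le> U" "L2_set z {1..m} \<le> R" for u w z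
  proof -
    have "\<bar>\<Phi> i u (restrict z {1..i})\<bar> \<le> B"
      using L2_set_subset_le[of "{1..m}" "{1..i}" z] i uz by (intro B) auto
    moreover have "\<bar>z (i + 1)\<bar> \<le> R" if "i < m"
      using abs_le_L2_set[of "{1..m}" "i + 1" z] that uz by auto
    ultimately show ?thesis using i by (cases "i < m") (auto simp: system_rhs_def)
  qed
  then show ?thesis by (intro exI[of _ "\<bar>R\<bar> + \<bar>B\<bar>"]) auto
qed

section \<open>The cascade\<close>

text \<open>Only the first \<open>n\<close> blocks are required, so a run restricts to fewer blocks.
  The constant \<open>S\<close> bounds both disturbances on the whole horizon, which reduces the
  supremum in the final estimate to a number.\<close>

definition observer_run ::
    "nat \<Rightarrow> (nat \<Rightarrow> real^'p \<Rightarrow> (nat \<Rightarrow> real) \<Rightarrow> real) \<Rightarrow> (nat \<Rightarrow> nat \<Rightarrow> real) \<Rightarrow> real \<Rightarrow> real \<Rightarrow> nat \<Rightarrow>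
     (nat \<Rightarrow> real) \<Rightarrow> real \<Rightarrow> real \<Rightarrow> (real \<Rightarrow> real^'p) \<Rightarrow> (real \<Rightarrow> real) \<Rightarrow> (real \<Rightarrow> nat \<Rightarrow> real) \<Rightarrow>
     (real \<Rightarrow> nat \<Rightarrow> real) \<Rightarrow> (real \<Rightarrow> nat \<Rightarrow> real) \<Rightarrow> (real \<Rightarrow> nat \<Rightarrow> nat \<Rightarrow> real) \<Rightarrow> bool" where
  "observer_run m \<Phi> k R U n L T S u v w wh Z Zh \<longleftrightarrow>
     (\<forall>i\<in>{1..m}. integral_curve {0..T} (\<lambda>s. system_rhs m \<Phi> (u s) (w s) (Z s) i) (\<lambda>s. Z s i)) \<and>
     (\<forall>i\<in>{1..n}. \<forall>j\<in>{1..i}. integral_curve {0..T}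
        (\<lambda>s. observer_rhs \<Phi> k L (u s) (wh s) (Z s 1 + v s) (Zh s) i j) (\<lambda>s. Zh s i j)) \<and>
     (\<forall>s\<in>{0..T}. L2_set (Z s) {1..m} \<le> R \<and> norm (u s) \<le> U \<and> \<bar>v s\<bar> \<le> S \<and>
        L2_set (\<lambda>l. wh s l - w s l) {1..m} \<le> S)"

definition observation_error :: "(real \<Rightarrow> nat \<Rightarrow> nat \<Rightarrow> real) \<Rightarrow> (real \<Rightarrow> nat \<Rightarrow> real) \<Rightarrow> nat \<Rightarrow> real \<Rightarrow> real" where
  "observation_error Zh Z i t = L2_set (\<lambda>j. Zh t i j - Z t j) {1..i}"

lemma observation_error_nonneg: "0 \<le> observation_error Zh Z i t"
  by (simp add: observation_error_def)

text \<open>A sum replaces the maximum since it is easier to propagate. All blocks share \<phi>,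
  \<gamma> and the rate one.\<close>

definition cascade_estimate ::
    "nat \<Rightarrow> (nat \<Rightarrow> real^'p \<Rightarrow> (nat \<Rightarrow> real) \<Rightarrow> real) \<Rightarrow> (nat \<Rightarrow> nat \<Rightarrow> real) \<Rightarrow> real \<Rightarrow> real \<Rightarrow> nat \<Rightarrow>
     (nat \<Rightarrow> real) \<Rightarrow> real \<Rightarrow> (real \<Rightarrow> real) \<Rightarrow> (real \<Rightarrow> real) \<Rightarrow> bool" where
  "cascade_estimate m \<Phi> k R U n L \<epsilon> \<phi> \<gamma> \<longleftrightarrow>
     (\<forall>T S u v w wh Z Zh. 0 \<le> S \<longrightarrow> observer_run m \<Phi> k R U n L T S u v w wh Z Zh \<longrightarrow>
       (\<forall>i\<in>{1..n}. \<forall>t\<in>{0..T}. observation_error Zh Z i t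
          \<le> \<epsilon> + \<phi> (\<Sum>j=1..i. observation_error Zh Z j 0) * exp (- t) + \<gamma> S))"

text \<open>Output injection carries \<open>v\<close> with its gain. Writing the ignored drift as
  \<open>system_rhs\<close> minus \<open>w\<close> covers \<open>i < m\<close> and
  \<open>i = m\<close> at once. For \<open>i = 1\<close> there is no \<open>j < i\<close>, so a
  block 0 is never read.\<close>

lemma block_solution_of_observer_run:
  assumes run: "observer_run m \<Phi> k R U n L T S u v w wh Z Zh"
    and i: "i \<in> {1..n}" and n: "n \<le> m"
  shows "block_solution k i (L i) T (\<lambda>j s. Zh s i j - Z s j)
    (\<lambda>j s. if j < i then \<Phi> j (u s) (restrict (Zh s (i - 1)) {1..j}) - \<Phi> j (u s) (restrict (Z s) {1..j})
                         + (wh s j - w s j) + L i ^ j * k i j * v s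
           else (wh s i - w s i) + L i ^ i * k i i * v s - (system_rhs m \<Phi> (u s) (w s) (Z s) i - w s i))"
  unfolding block_solution_def
proof (intro ballI)
  fix j t assume j: "j \<in> {1..i}" and t: "t \<in> {0..T}"
  have "((\<lambda>s. observer_rhs \<Phi> k L (u s) (wh s) (Z s 1 + v s) (Zh s) i j) has_integral (Zh t i j - Zh 0 i j)) {0..t}"
    using run i j t unfolding observer_run_def integral_curve_def by blast
  moreover have "((\<lambda>s. system_rhs m \<Phi> (u s) (w s) (Z s) j) has_integral (Z t j - Z 0 j)) {0..t}"
    using run i n j t unfolding observer_run_def integral_curve_def by auto
  ultimately have "((\<lambda>s. observer_rhs \<Phi> k L (u s) (wh s) (Z s 1 + v s) (Zh s) i j - system_rhs m \<Phi> (u s) (w s) (Z s) j)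
     has_integral (Zh t i j - Zh 0 i j - (Z t j - Z 0 j))) {0..t}"
    by (rule has_integral_diff)
  moreover have "observer_rhs \<Phi> k L (u s) (wh s) (Z s 1 + v s) (Zh s) i j - system_rhs m \<Phi> (u s) (w s) (Z s) j
    = (if j < i then Zh s i (Suc j) - Z s (Suc j) else 0) - L i ^ j * k i j * (Zh s i 1 - Z s 1)
      + (if j < i then \<Phi> j (u s) (restrict (Zh s (i - 1)) {1..j}) - \<Phi> j (u s) (restrict (Z s) {1..j})
                         + (wh s j - w s j) + L i ^ j * k i j * v s
           else (wh s i - w s i) + L i ^ i * k i i * v s - (system_rhs m \<Phi> (u s) (w s) (Z s) i - w s i))" for s
  proof (cases "j < i")
    case True
    then have "j < m" using i n by auto
    with True show ?thesis by (simp add: observer_rhs_def system_rhs_def algebra_simps)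
  next
    case False
    then have "j = i" using j by simp
    then show ?thesis by (simp add: observer_rhs_def algebra_simps)
  qed
  ultimately show "((\<lambda>s. (if j < i then Zh s i (Suc j) - Z s (Suc j) else 0) - L i ^ j * k i j * (Zh s i 1 - Z s 1)
      + (if j < i then \<Phi> j (u s) (restrict (Zh s (i - 1)) {1..j}) - \<Phi> j (u s) (restrict (Z s) {1..j})
                         + (wh s j - w s j) + L i ^ j * k i j * v s
           else (wh s i - w s i) + L i ^ i * k i i * v s - (system_rhs m \<Phi> (u s) (w s) (Z s) i - w s i)))
     has_integral (Zh t i j - Z t j - (Zh 0 i j - Z 0 j))) {0..t}"
    by (simp only: diff_diff_eq2 diff_diff_eq add_diff_eq diff_add_eq add.commute)
qed

text \<open>The new gain \<open>l\<close> is fixed first, from the drift bound; then \<eta>,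
  relative to the amplification \<open>P\<close>; then the tolerance \<epsilon>' asked of the
  previous blocks. No constant depends on a later one.\<close>

lemma cascade_step:
  fixes \<Phi> :: "nat \<Rightarrow> real^'p \<Rightarrow> (nat \<Rightarrow> real) \<Rightarrow> real"
  assumes \<Phi>: "Phi_continuous m \<Phi>" and hur: "hurwitz (gain_poly k (Suc n))" and n: "Suc n \<le> m"
    and IH: "\<And>\<epsilon>. \<epsilon> > 0 \<Longrightarrow> \<exists>L \<phi> \<gamma>. (\<forall>i\<in>{1..n}. L i > 0) \<and> star_K \<phi> \<and> star_K \<gamma> \<and> cascade_estimate m \<Phi> k R U n L \<epsilon> \<phi> \<gamma>"
    and \<epsilon>: "\<epsilon> > 0"
  shows "\<exists>L \<phi> \<gamma>. (\<forall>i\<in>{1..Suc n}. L i > 0) \<and> star_K \<phi> \<and> star_K \<gamma> \<and> cascade_estimate m \<Phi> k R U (Suc n) L \<epsilon> \<phi> \<gamma>"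
proof -
  obtain C a where C: "C > 0" and a: "1 \<le> a" and gain: "block_gain k (Suc n) C a"
    using block_gain_exists[OF hur] by blast
  have "Suc n \<in> {1..m}" using n by simp
  from unmodelled_drift_bounded[OF \<Phi> this, of U R] obtain D where D: "D \<ge> 0"
    "\<And>u w z. norm u \<le> U \<Longrightarrow> L2_set z {1..m} \<le> R \<Longrightarrow> \<bar>system_rhs m \<Phi> u w z (Suc n) - w (Suc n)\<bar> \<le> D"
    by blast
  \<comment> \<open>The factor \<open>Suc n\<close> converts bounds on components into one on the
    Euclidean norm.\<close>
  define C' where "C' = real (Suc n) * C"
  have C': "C' > 0" using C by (simp add: C'_def)
  \<comment> \<open>Large enough for the drift to use at most half of the tolerance.\<close>
  define l where "l = max a (2 * C' * D / \<epsilon>)"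
  have l1: "l \<ge> 1" using a by (simp add: l_def)
  have "2 * C' * D / \<epsilon> \<le> l" by (simp add: l_def)
  then have Dl: "C' * (D / l) \<le> \<epsilon> / 2" using l1 \<epsilon> by (simp add: field_simps)
  define P where "P = l ^ Suc n"
  have P: "P > 0" unfolding P_def using l1 by (intro zero_less_power) linarith
  \<comment> \<open>The other half covers \<open>2 * \<eta>\<close> after amplification: one \<eta>
    from the modulus, one from the tolerance of the previous block passed through
    \<open>q\<close>.\<close>
  define \<eta> where "\<eta> = \<epsilon> / (4 * C' * P)"
  have \<eta>: "\<eta> > 0" using \<epsilon> C' P by (simp add: \<eta>_def)
  have \<eta>_eq: "C' * (P * (2 * \<eta>)) = \<epsilon> / 2" using C' P by (simp add: \<eta>_def)
  have "n \<le> m" using n by simp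
  from Phi_modulus[OF \<Phi> \<eta> this, of U R] obtain q where q: "star_K q"
    "\<And>j u z y. j \<in> {1..n} \<Longrightarrow> norm u \<le> U \<Longrightarrow> L2_set z {1..m} \<le> R \<Longrightarrow>
      \<bar>\<Phi> j u (restrict y {1..j}) - \<Phi> j u (restrict z {1..j})\<bar> \<le> \<eta> + q (L2_set (\<lambda>l. y l - z l) {1..n})"
    by blast
  obtain \<delta> where \<delta>: "\<delta> > 0" "q \<delta> \<le> \<eta>" using star_K_arbitrarily_small[OF q(1) \<eta>] by blast
  \<comment> \<open>The third anticipates \<open>star_K_add3_le\<close>; the bound by \<epsilon>
    keeps the estimates of the old blocks valid.\<close>
  define \<epsilon>' where "\<epsilon>' = min \<epsilon> (\<delta> / 3)"
  have \<epsilon>': "\<epsilon>' > 0" "\<epsilon>' \<le> \<epsilon>" using \<epsilon> \<delta> by (auto simp: \<epsilon>'_def)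
  have "q (3 * \<epsilon>') \<le> q \<delta>" using \<epsilon>' by (intro star_K_mono[OF q(1)]) (auto simp: \<epsilon>'_def)
  then have q\<epsilon>': "q (3 * \<epsilon>') \<le> \<eta>" using \<delta> by simp
  obtain L' \<phi>' \<gamma>' where L': "\<forall>i\<in>{1..n}. L' i > 0" and \<phi>': "star_K \<phi>'" and \<gamma>': "star_K \<gamma>'"
    and est: "cascade_estimate m \<Phi> k R U n L' \<epsilon>' \<phi>' \<gamma>'"
    using IH[OF \<epsilon>'(1)] by blast
  define L where "L = L'(Suc n := l)"
  \<comment> \<open>Dominates \<open>1 + \<bar>k (Suc n) j\<bar>\<close>: the 1 is for the
    disturbance of the dynamics, the gain for that of the measurement.\<close>
  define \<kappa> where "\<kappa> = 1 + (\<Sum>j=1..Suc n. \<bar>k (Suc n) j\<bar>)"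
  have \<kappa>: "\<kappa> > 0" unfolding \<kappa>_def by (intro add_pos_nonneg sum_nonneg) auto
  have k\<kappa>: "1 + \<bar>k (Suc n) j\<bar> \<le> \<kappa>" if "j \<in> {1..Suc n}" for j
    unfolding \<kappa>_def using that member_le_sum[of j "{1..Suc n}" "\<lambda>j. \<bar>k (Suc n) j\<bar>"] by auto
  \<comment> \<open>The old functions serve blocks up to \<open>n\<close>. The added terms serve the
    new block: its own initial error or disturbances, and what block \<open>n\<close> transmits
    through \<open>q\<close>.\<close>
  define \<phi> where "\<phi> r = \<phi>' r + (C' * P) * (r + q (3 * \<phi>' r))" for r
  define \<gamma> where "\<gamma> S = \<gamma>' S + (C' * P) * (q (3 * \<gamma>' S) + \<kappa> * S)" for S
  have CP: "C' * P > 0" using C' P by simp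
  have q3: "star_K (\<lambda>x. q (3 * x))" using star_K_compose[OF q(1) star_K_cmult[OF star_K_id, of 3]] by simp
  have "star_K \<phi>"
    unfolding \<phi>_def by (intro star_K_add star_K_cmult \<phi>' star_K_id star_K_compose[OF q3] CP)
  moreover have "star_K \<gamma>"
    unfolding \<gamma>_def by (intro star_K_add star_K_cmult \<gamma>' star_K_id star_K_compose[OF q3] CP \<kappa>)
  moreover have "\<forall>i\<in>{1..Suc n}. L i > 0" using L' l1 by (auto simp: L_def)
  moreover have "cascade_estimate m \<Phi> k R U (Suc n) L \<epsilon> \<phi> \<gamma>"
    unfolding cascade_estimate_def
  proof (intro allI impI ballI)
    fix T S u v w wh Z Zh i t
    assume S: "0 \<le> S" and run: "observer_run m \<Phi> k R U (Suc n) L T S u v w wh Z Zh"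
      and i: "i \<in> {1..Suc n}" and t: "t \<in> {0..T}"
    define err where "err = observation_error Zh Z"
    have err0: "err i t \<ge> 0" for i t by (simp add: err_def observation_error_nonneg)
    define r where "r i = (\<Sum>j=1..i. err j 0)" for i
    have r0: "r i \<ge> 0" for i unfolding r_def by (intro sum_nonneg err0)
    have bd: "L2_set (Z s) {1..m} \<le> R" "norm (u s) \<le> U" "\<bar>v s\<bar> \<le> S" "L2_set (\<lambda>l. wh s l - w s l) {1..m} \<le> S"
      if "s \<in> {0..T}" for s
      using run that by (auto simp: observer_run_def)
    have "observer_rhs \<Phi> k L' uu ww yy zz i j = observer_rhs \<Phi> k L uu ww yy zz i j" if "i \<le> n" for i j uu ww yy zz
      using that by (simp add: observer_rhs_def L_def)
    then have "observer_run m \<Phi> k R U n L' T S u v w wh Z Zh"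
      using run by (simp add: observer_run_def)
    then have old: "err i s \<le> \<epsilon>' + \<phi>' (r i) * exp (- s) + \<gamma>' S" if "i \<in> {1..n}" "s \<in> {0..T}" for i s
      using est S that unfolding cascade_estimate_def err_def r_def by blast
    show "observation_error Zh Z i t \<le> \<epsilon> + \<phi> (\<Sum>j=1..i. observation_error Zh Z j 0) * exp (- t) + \<gamma> S"
      unfolding err_def[symmetric] r_def[symmetric]
    proof (cases "i = Suc n")
      case False
      then have "err i t \<le> \<epsilon>' + \<phi>' (r i) * exp (- t) + \<gamma>' S" using i t by (intro old) auto
      moreover have "\<phi>' (r i) \<le> \<phi> (r i)"
        unfolding \<phi>_def using CP r0[of i] star_K_nonneg[OF q(1), of "3 * \<phi>' (r i)"] star_K_nonneg[OF \<phi>', of "r i"] by simp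
      then have "\<phi>' (r i) * exp (- t) \<le> \<phi> (r i) * exp (- t)" by simp
      moreover have "\<gamma>' S \<le> \<gamma> S"
        unfolding \<gamma>_def using CP S \<kappa> star_K_nonneg[OF q(1), of "3 * \<gamma>' S"] star_K_nonneg[OF \<gamma>', of S] by simp
      ultimately show "err i t \<le> \<epsilon> + \<phi> (r i) * exp (- t) + \<gamma> S" using \<epsilon>' by linarith
    next
      case True
      define \<rho> where "\<rho> = r (Suc n)"
      have r_Suc: "\<rho> = r n + err (Suc n) 0" by (simp add: \<rho>_def r_def)
      have \<rho>0: "\<rho> \<ge> 0" by (simp add: \<rho>_def r0)
      have \<phi>\<rho>: "\<phi>' \<rho> \<ge> 0" and \<gamma>S: "\<gamma>' S \<ge> 0" using star_K_nonneg \<phi>' \<gamma>' \<rho>0 S by auto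
      define Q where "Q = q (3 * \<phi>' \<rho>)"
      define G where "G = q (3 * \<gamma>' S)"
      have Q: "Q \<ge> 0" and G: "G \<ge> 0" unfolding Q_def G_def using \<phi>\<rho> \<gamma>S by (auto intro: star_K_nonneg[OF q(1)])
      \<comment> \<open>Star-shapedness with factor \<open>exp (- s)\<close> carries the decay
        through \<open>q\<close>. The first block has no predecessor, hence
        \<open>n >= 1\<close>.\<close>
      have qerr: "q (err n s) \<le> \<eta> + Q * exp (- s) + G" if "n \<ge> 1" and s: "s \<in> {0..T}" for s
      proof -
        have es: "exp (- s) \<le> 1" using s by simp
        have "\<phi>' (r n) \<le> \<phi>' \<rho>" using r0[of n] err0[of "Suc n" 0] by (intro star_K_mono[OF \<phi>']) (auto simp: r_Suc)
        then have "\<phi>' (r n) * exp (- s) \<le> \<phi>' \<rho> * exp (- s)" by simp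
        moreover have "err n s \<le> \<epsilon>' + \<phi>' (r n) * exp (- s) + \<gamma>' S" using that by (intro old) auto
        ultimately have "err n s \<le> \<epsilon>' + \<phi>' \<rho> * exp (- s) + \<gamma>' S" by linarith
        then have "q (err n s) \<le> q (\<epsilon>' + \<phi>' \<rho> * exp (- s) + \<gamma>' S)"
          by (intro star_K_mono[OF q(1)] err0)
        also have "\<dots> \<le> q (3 * \<epsilon>') + q (3 * (\<phi>' \<rho> * exp (- s))) + q (3 * \<gamma>' S)"
          using \<epsilon>' \<phi>\<rho> \<gamma>S by (intro star_K_add3_le[OF q(1)]) auto
        also have "q (3 * (\<phi>' \<rho> * exp (- s))) \<le> exp (- s) * Q"
          unfolding Q_def using star_K_scale_le[OF q(1), of "3 * \<phi>' \<rho>" "exp (- s)"] \<phi>\<rho> es by (simp add: mult_ac)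
        finally show ?thesis using q\<epsilon>' by (simp add: G_def mult.commute)
      qed
      define f where "f j s = (if j < Suc n then \<Phi> j (u s) (restrict (Zh s n) {1..j}) - \<Phi> j (u s) (restrict (Z s) {1..j})
                         + (wh s j - w s j) + l ^ j * k (Suc n) j * v s
           else (wh s (Suc n) - w s (Suc n)) + l ^ Suc n * k (Suc n) (Suc n) * v s
             - (system_rhs m \<Phi> (u s) (w s) (Z s) (Suc n) - w s (Suc n)))" for j s
      have Ll: "L (Suc n) = l" by (simp add: L_def)
      have sol: "block_solution k (Suc n) l T (\<lambda>j s. Zh s (Suc n) j - Z s j) f"
        using block_solution_of_observer_run[OF run _ n, of "Suc n", unfolded Ll diff_Suc_1]
        unfolding f_def[abs_def] by simp
      define F0 where "F0 = D + P * (2 * \<eta> + G + \<kappa> * S)"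
      define F1 where "F1 = P * Q"
      have F: "F0 \<ge> 0" "F1 \<ge> 0" using D P \<eta> G \<kappa> S Q by (auto simp: F0_def F1_def)
      have fb: "l ^ (Suc n - j) * \<bar>f j s\<bar> \<le> F0 + F1 * exp (- s)" if j: "j \<in> {1..Suc n}" and s: "s \<in> {0..T}" for j s
      proof -
        have lj: "l ^ (Suc n - j) * l ^ j = P" using j by (simp add: P_def flip: power_add del: power_Suc)
        have lP: "0 \<le> l ^ (Suc n - j)" "l ^ (Suc n - j) \<le> P"
          unfolding P_def using l1 by (auto intro!: power_increasing simp del: power_Suc)
        have "\<bar>wh s j - w s j\<bar> \<le> S"
          using abs_le_L2_set[of "{1..m}" j "\<lambda>l. wh s l - w s l"] bd(4)[OF s] j n by auto
        then have w: "l ^ (Suc n - j) * \<bar>wh s j - w s j\<bar> \<le> P * S"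
          using lP by (intro mult_mono) auto
        have "l ^ (Suc n - j) * \<bar>l ^ j * k (Suc n) j * v s\<bar> = P * (\<bar>k (Suc n) j\<bar> * \<bar>v s\<bar>)"
          using l1 by (simp add: abs_mult lj[symmetric] mult_ac)
        also have "\<dots> \<le> P * (\<bar>k (Suc n) j\<bar> * S)"
          using P bd(3)[OF s] by (intro mult_left_mono) auto
        finally have v: "l ^ (Suc n - j) * \<bar>l ^ j * k (Suc n) j * v s\<bar> \<le> P * (\<bar>k (Suc n) j\<bar> * S)" .
        have "P * ((1 + \<bar>k (Suc n) j\<bar>) * S) \<le> P * (\<kappa> * S)"
          using P S k\<kappa>[OF j] by (intro mult_left_mono mult_right_mono) auto
        with w v have wv: "l ^ (Suc n - j) * \<bar>wh s j - w s j\<bar> + l ^ (Suc n - j) * \<bar>l ^ j * k (Suc n) j * v s\<bar> \<le> P * (\<kappa> * S)"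
          by (simp add: algebra_simps)
        \<comment> \<open>What is left of \<open>f\<close> without disturbances: an increment of
          \<open>\<Phi> j\<close>, or the drift when \<open>j = Suc n\<close>.\<close>
        define X where "X = f j s - (wh s j - w s j) - l ^ j * k (Suc n) j * v s"
        have X: "l ^ (Suc n - j) * \<bar>X\<bar> \<le> D + P * (2 * \<eta> + G) + P * Q * exp (- s)"
        proof (cases "j < Suc n")
          case True
          then have jn: "j \<in> {1..n}" using j by auto
          have "X = \<Phi> j (u s) (restrict (Zh s n) {1..j}) - \<Phi> j (u s) (restrict (Z s) {1..j})"
            using True by (simp add: X_def f_def)
          then have "\<bar>X\<bar> \<le> \<eta> + q (err n s)"
            using q(2)[OF jn bd(2)[OF s] bd(1)[OF s], of "Zh s n"] by (simp add: err_def observation_error_def)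
          also have "\<dots> \<le> 2 * \<eta> + G + Q * exp (- s)" using qerr[OF _ s] jn by simp
          finally have "l ^ (Suc n - j) * \<bar>X\<bar> \<le> P * (2 * \<eta> + G + Q * exp (- s))"
            using lP by (intro mult_mono) auto
          then show ?thesis using D(1) by (simp add: algebra_simps)
        next
          case False
          \<comment> \<open>The weight is \<open>l ^ 0 = 1\<close>, so \<open>D\<close> is not
            multiplied by \<open>P\<close>.\<close>
          then have j: "j = Suc n" using j by simp
          then have "X = - (system_rhs m \<Phi> (u s) (w s) (Z s) (Suc n) - w s (Suc n))" by (simp add: X_def f_def)
          then have "\<bar>X\<bar> \<le> D" using D(2)[OF bd(2)[OF s] bd(1)[OF s], of "w s"] by simp
          moreover have "P * (2 * \<eta> + G) + P * Q * exp (- s) \<ge> 0" using P \<eta> G Q by simp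
          ultimately show ?thesis using j by simp
        qed
        have "\<bar>f j s\<bar> \<le> \<bar>X\<bar> + (\<bar>wh s j - w s j\<bar> + \<bar>l ^ j * k (Suc n) j * v s\<bar>)" unfolding X_def by linarith
        then have "l ^ (Suc n - j) * \<bar>f j s\<bar> \<le> l ^ (Suc n - j) * (\<bar>X\<bar> + (\<bar>wh s j - w s j\<bar> + \<bar>l ^ j * k (Suc n) j * v s\<bar>))"
          using lP by (intro mult_left_mono) auto
        also have "\<dots> \<le> D + P * (2 * \<eta> + G) + P * Q * exp (- s) + P * (\<kappa> * S)"
          using X wv by (simp add: distrib_left)
        finally show ?thesis by (simp add: F0_def F1_def algebra_simps)
      qed
      define e where "e = exp (- t)"
      have e: "e > 0" by (simp add: e_def)
      define B where "B = C * (P * \<rho> * e + (F0 + F1 * e) / l)"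
      have "err (Suc n) 0 \<le> \<rho>" using r0[of n] by (simp add: r_Suc)
      then have e0: "\<bar>Zh 0 (Suc n) j - Z 0 j\<bar> \<le> \<rho>" if "j \<in> {1..Suc n}" for j
        using abs_le_L2_set[of "{1..Suc n}" j "\<lambda>j. Zh 0 (Suc n) j - Z 0 j"] that
        by (simp add: err_def observation_error_def)
      have "\<bar>Zh t (Suc n) j - Z t j\<bar> \<le> B" if "j \<in> {1..Suc n}" for j
        unfolding B_def e_def P_def
        by (rule gain[unfolded block_gain_def, rule_format, OF _ \<rho>0 F sol e0 fb that t])
          (simp_all add: l_def)
      then have "err (Suc n) t \<le> (\<Sum>j=1..Suc n. B)"
        unfolding err_def observation_error_def by (intro order.trans[OF L2_set_le_sum_abs] sum_mono) auto
      also have "\<dots> = C' * (P * \<rho> * e + (F0 + F1 * e) / l)" by (simp add: B_def C'_def)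
      \<comment> \<open>Only the drift needs the division by \<open>l\<close>; for the other terms
        \<open>l >= 1\<close> is enough.\<close>
      also have "(F0 + F1 * e) / l = D / l + (P * (2 * \<eta> + G + \<kappa> * S) + P * Q * e) / l"
        by (simp add: F0_def F1_def add_divide_distrib)
      also have "(P * (2 * \<eta> + G + \<kappa> * S) + P * Q * e) / l \<le> P * (2 * \<eta> + G + \<kappa> * S) + P * Q * e"
      proof -
        have "0 \<le> P * (2 * \<eta> + G + \<kappa> * S) + P * Q * e" using P \<eta> G \<kappa> S Q e by simp
        then show ?thesis using l1 divide_left_mono[of 1 l "P * (2 * \<eta> + G + \<kappa> * S) + P * Q * e"] by simp
      qed
      also have "C' * (P * \<rho> * e + (D / l + (P * (2 * \<eta> + G + \<kappa> * S) + P * Q * e)))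
        = C' * (D / l) + C' * (P * (2 * \<eta>)) + C' * P * (\<rho> + Q) * e + C' * P * (G + \<kappa> * S)"
        by (simp add: algebra_simps)
      also have "\<dots> \<le> \<epsilon> + \<phi> \<rho> * e + \<gamma> S"
      proof -
        have "C' * P * (\<rho> + Q) * e \<le> \<phi> \<rho> * e"
          using \<phi>\<rho> e by (simp add: \<phi>_def Q_def)
        moreover have "C' * P * (G + \<kappa> * S) \<le> \<gamma> S" using \<gamma>S by (simp add: \<gamma>_def G_def)
        ultimately show ?thesis using Dl \<eta>_eq by linarith
      qed
      finally show "err i t \<le> \<epsilon> + \<phi> (r i) * exp (- t) + \<gamma> S"
        using C' by (simp add: True \<rho>_def e_def)
    qed
  qed
  ultimately show ?thesis by blast
qed

lemma cascade_estimate_exists: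
  fixes \<Phi> :: "nat \<Rightarrow> real^'p \<Rightarrow> (nat \<Rightarrow> real) \<Rightarrow> real"
  assumes \<Phi>: "Phi_continuous m \<Phi>" and hur: "\<forall>i\<in>{1..m}. hurwitz (gain_poly k i)"
    and "n \<le> m" "\<epsilon> > 0"
  shows "\<exists>L \<phi> \<gamma>. (\<forall>i\<in>{1..n}. L i > 0) \<and> star_K \<phi> \<and> star_K \<gamma> \<and> cascade_estimate m \<Phi> k R U n L \<epsilon> \<phi> \<gamma>"
  using assms(3,4)
\<comment> \<open>The tolerance varies because the step invokes the hypothesis at one computed from
  the new gain.\<close>
proof (induction n arbitrary: \<epsilon>)
  case 0
  show ?case
    by (intro exI[of _ "\<lambda>_. 1"] exI[of _ "\<lambda>x. x"] conjI star_K_id) (auto simp: cascade_estimate_def)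
next
  case (Suc n)
  show ?case
    by (rule cascade_step[OF \<Phi> _ Suc.prems(1) Suc.IH Suc.prems(2)]) (use hur Suc.prems in auto)
qed

section \<open>From the additive estimate to comparison functions and maxima\<close>

lemma class_KL_exp_decay:
  assumes \<phi>: "class_K \<phi>"
  shows "class_KL (\<lambda>r t. \<phi> r * exp (- t))"
  unfolding class_KL_def
proof (intro conjI allI impI)
  have c: "continuous_on {0..} \<phi>" using \<phi> by (simp add: class_K_def)
  then show "continuous_on ({0..} \<times> {0..}) (\<lambda>(r, t). \<phi> r * exp (- t))"
    unfolding case_prod_unfold
    by (intro continuous_intros continuous_on_compose2[OF c, of _ fst]) auto
  show "class_K (\<lambda>r. \<phi> r * exp (- t))" for t
    using \<phi> by (auto simp: class_K_def strict_mono_on_def intro!: continuous_intros)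
  show "antimono_on {0..} (\<lambda>t. \<phi> r * exp (- t))" if "r \<ge> 0" for r
    using class_K_nonneg[OF \<phi> that] by (auto simp: monotone_on_def intro!: mult_left_mono)
  have "((\<lambda>t. exp (- t)) \<longlongrightarrow> (0::real)) at_top"
    by (rule filterlim_compose[OF exp_at_bot filterlim_uminus_at_bot_at_top])
  then show "((\<lambda>t. \<phi> r * exp (- t)) \<longlongrightarrow> 0) at_top" for r
    by (rule tendsto_mult_right_zero)
qed

text \<open>Ensures that the supremum over \<open>{0..t}\<close> is taken over a bounded family and
  so is a genuine least upper bound.\<close>

lemma disturbance_bounded:
  assumes v: "admissible_signal (v :: real \<Rightarrow> real)"
    and w: "\<forall>i\<in>{1..m}. admissible_signal (\<lambda>s. w s i :: real)"
    and wh: "\<forall>i\<in>{1..m}. admissible_signal (\<lambda>s. wh s i :: real)" and t: "t \<ge> 0"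
  shows "\<exists>B. \<forall>s\<in>{0..t}. max \<bar>v s\<bar> (L2_set (\<lambda>l. wh s l - w s l) {1..m}) \<le> B"
proof -
  have bd: "\<exists>B. \<forall>s\<in>{0..t}. \<bar>f s\<bar> \<le> B" if "admissible_signal f" for f :: "real \<Rightarrow> real"
    using that t unfolding admissible_signal_def bounded_iff by fastforce
  obtain V where V: "\<forall>s\<in>{0..t}. \<bar>v s\<bar> \<le> V" using bd[OF v] by blast
  have "\<forall>i\<in>{1..m}. \<exists>B. \<forall>s\<in>{0..t}. \<bar>w s i\<bar> \<le> B" using bd w by blast
  then obtain W where W: "\<forall>i\<in>{1..m}. \<forall>s\<in>{0..t}. \<bar>w s i\<bar> \<le> W i" by metis
  have "\<forall>i\<in>{1..m}. \<exists>B. \<forall>s\<in>{0..t}. \<bar>wh s i\<bar> \<le> B" using bd wh by blast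
  then obtain Wh where Wh: "\<forall>i\<in>{1..m}. \<forall>s\<in>{0..t}. \<bar>wh s i\<bar> \<le> Wh i" by metis
  have "L2_set (\<lambda>l. wh s l - w s l) {1..m} \<le> (\<Sum>i=1..m. Wh i + W i)" if s: "s \<in> {0..t}" for s
  proof (intro order.trans[OF L2_set_le_sum_abs] sum_mono)
    fix i assume i: "i \<in> {1..m}"
    have "\<bar>w s i\<bar> \<le> W i" "\<bar>wh s i\<bar> \<le> Wh i" using W Wh i s by blast+
    then show "\<bar>wh s i - w s i\<bar> \<le> Wh i + W i" by linarith
  qed
  with V show ?thesis
    by (intro exI[of _ "max V (\<Sum>i=1..m. Wh i + W i)"] ballI max.mono) auto
qed

theorem proposition3:
  fixes m :: nat
    and \<Phi> :: "nat \<Rightarrow> real^'p \<Rightarrow> (nat \<Rightarrow> real) \<Rightarrow> real"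
    and k :: "nat \<Rightarrow> nat \<Rightarrow> real"
    and zbar ubar \<epsilon> :: real
  assumes "1 \<le> m"
    and "Phi_continuous m \<Phi>"
    and "forward_complete m \<Phi>"
    and "\<forall>i\<in>{1..m}. hurwitz (gain_poly k i)"
    and "zbar > 0" and "ubar > 0" and "\<epsilon> > 0"
  shows "\<exists>(L :: nat \<Rightarrow> real) \<beta> \<gamma>1 \<gamma>2.
    (\<forall>i\<in>{1..m}. L i > 0) \<and> class_KL \<beta> \<and> class_K_inf \<gamma>1 \<and> class_K_inf \<gamma>2 \<and>
    (\<forall>(u :: real \<Rightarrow> real^'p) (v :: real \<Rightarrow> real) (w :: real \<Rightarrow> nat \<Rightarrow> real)
       (wh :: real \<Rightarrow> nat \<Rightarrow> real) (z :: nat \<Rightarrow> real) (zh :: nat \<Rightarrow> nat \<Rightarrow> real)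
       (Z :: real \<Rightarrow> nat \<Rightarrow> real) (t :: real) (Zh :: real \<Rightarrow> nat \<Rightarrow> nat \<Rightarrow> real).
       admissible_signal u \<longrightarrow> admissible_signal v \<longrightarrow>
       (\<forall>i\<in>{1..m}. admissible_signal (\<lambda>s. w s i)) \<longrightarrow>
       (\<forall>i\<in>{1..m}. admissible_signal (\<lambda>s. wh s i)) \<longrightarrow>
       system_solution m \<Phi> u w {0..} z Z \<longrightarrow>
       t \<ge> 0 \<longrightarrow>
       (\<forall>s\<in>{0..t}. L2_set (Z s) {1..m} \<le> zbar \<and> norm (u s) \<le> ubar) \<longrightarrow>
       observer_solution m \<Phi> k L u wh (\<lambda>s. Z s 1 + v s) {0..t} zh Zh \<longrightarrow>
       (\<forall>i\<in>{1..m}.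
          L2_set (\<lambda>j. Zh t i j - Z t j) {1..i}
            \<le> max \<epsilon>
                (max (\<beta> (\<Sum>j=1..i. L2_set (\<lambda>l. zh j l - z l) {1..j}) t)
                   (SUP s\<in>{0..t}. max (\<gamma>1 \<bar>v s\<bar>)
                      (\<gamma>2 (L2_set (\<lambda>l. wh s l - w s l) {1..m}))))))"
proof -
  \<comment> \<open>A sum of three terms is at most the largest of their triples: hence the
    tolerance \<open>\<epsilon> / 3\<close> and the factors 3 in \<beta> and \<gamma>'.\<close>
  obtain L \<phi> \<gamma> where L: "\<forall>i\<in>{1..m}. L i > 0" and \<phi>: "star_K \<phi>" and \<gamma>: "star_K \<gamma>"
    and est: "cascade_estimate m \<Phi> k zbar ubar m L (\<epsilon> / 3) \<phi> \<gamma>"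
    using cascade_estimate_exists[OF assms(2,4), of m "\<epsilon> / 3" zbar ubar] \<open>\<epsilon> > 0\<close> by auto
  define \<beta> where "\<beta> r t = 3 * \<phi> r * exp (- t)" for r t :: real
  define \<gamma>' where "\<gamma>' x = 3 * \<gamma> (2 * x)" for x
  have \<beta>: "class_KL \<beta>"
    unfolding \<beta>_def by (intro class_KL_exp_decay star_K_imp_class_K star_K_cmult \<phi>) simp
  have \<gamma>': "star_K \<gamma>'"
    unfolding \<gamma>'_def by (intro star_K_cmult star_K_compose[OF \<gamma>] star_K_id) simp_all
  have main: "L2_set (\<lambda>j. Zh t i j - Z t j) {1..i}
      \<le> max \<epsilon> (max (\<beta> (\<Sum>j=1..i. L2_set (\<lambda>l. zh j l - z l) {1..j}) t)
            (SUP s\<in>{0..t}. max (\<gamma>' \<bar>v s\<bar>) (\<gamma>' (L2_set (\<lambda>l. wh s l - w s l) {1..m}))))"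
    if v: "admissible_signal v"
      and w: "\<forall>i\<in>{1..m}. admissible_signal (\<lambda>s. w s i)" and wh: "\<forall>i\<in>{1..m}. admissible_signal (\<lambda>s. wh s i)"
      and sys: "system_solution m \<Phi> u w {0..} z Z" and t: "t \<ge> 0"
      and bd: "\<forall>s\<in>{0..t}. L2_set (Z s) {1..m} \<le> zbar \<and> norm (u s) \<le> ubar"
      and obs: "observer_solution m \<Phi> k L u wh (\<lambda>s. Z s 1 + v s) {0..t} zh Zh"
      and i: "i \<in> {1..m}"
    for u v w wh z zh Z t Zh i
  proof -
    \<comment> \<open>Using one monotone \<gamma>' for both disturbances lets the maximum move
      inside, which leaves a single scalar signal.\<close>
    define X where "X s = max \<bar>v s\<bar> (L2_set (\<lambda>l. wh s l - w s l) {1..m})" for s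
    have X0: "X s \<ge> 0" for s by (simp add: X_def le_max_iff_disj)
    have \<gamma>'X: "max (\<gamma>' \<bar>v s\<bar>) (\<gamma>' (L2_set (\<lambda>l. wh s l - w s l) {1..m})) = \<gamma>' (X s)" for s
      using star_K_mono[OF \<gamma>', of "\<bar>v s\<bar>" "L2_set (\<lambda>l. wh s l - w s l) {1..m}"]
        star_K_mono[OF \<gamma>', of "L2_set (\<lambda>l. wh s l - w s l) {1..m}" "\<bar>v s\<bar>"]
      unfolding X_def by (auto simp: max_def)
    obtain B where B: "\<And>s. s \<in> {0..t} \<Longrightarrow> X s \<le> B"
      using disturbance_bounded[OF v w wh t] unfolding X_def by blast
    define S where "S = (SUP s\<in>{0..t}. X s)"
    have bX: "bdd_above (X ` {0..t})" using B by (rule bdd_aboveI2)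
    have XS: "X s \<le> S" if "s \<in> {0..t}" for s
      unfolding S_def using bX that by (rule cSUP_upper[rotated])
    have S0: "S \<ge> 0" using XS[of 0] X0[of 0] t by simp
    have "observer_run m \<Phi> k zbar ubar m L t S u v w wh Z Zh"
      unfolding observer_run_def
    proof (intro conjI)
      show "\<forall>i\<in>{1..m}. integral_curve {0..t} (\<lambda>s. system_rhs m \<Phi> (u s) (w s) (Z s) i) (\<lambda>s. Z s i)"
        using sys unfolding system_solution_def integral_curve_def by auto
      show "\<forall>i\<in>{1..m}. \<forall>j\<in>{1..i}. integral_curve {0..t}
          (\<lambda>s. observer_rhs \<Phi> k L (u s) (wh s) (Z s 1 + v s) (Zh s) i j) (\<lambda>s. Zh s i j)"
        using obs unfolding observer_solution_def by auto
      show "\<forall>s\<in>{0..t}. L2_set (Z s) {1..m} \<le> zbar \<and> norm (u s) \<le> ubar \<and> \<bar>v s\<bar> \<le> S \<and>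
          L2_set (\<lambda>l. wh s l - w s l) {1..m} \<le> S"
        using bd XS unfolding X_def by auto
    qed
    then have "observation_error Zh Z i t
        \<le> \<epsilon> / 3 + \<phi> (\<Sum>j=1..i. observation_error Zh Z j 0) * exp (- t) + \<gamma> S"
      using est S0 i t unfolding cascade_estimate_def by auto
    moreover have "(\<Sum>j=1..i. observation_error Zh Z j 0) = (\<Sum>j=1..i. L2_set (\<lambda>l. zh j l - z l) {1..j})"
      using obs sys i unfolding observation_error_def observer_solution_def system_solution_def
      by (intro sum.cong L2_set_cong refl) auto
    ultimately have le: "L2_set (\<lambda>j. Zh t i j - Z t j) {1..i}
        \<le> \<epsilon> / 3 + \<beta> (\<Sum>j=1..i. L2_set (\<lambda>l. zh j l - z l) {1..j}) t / 3 + \<gamma> S"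
      by (simp add: observation_error_def \<beta>_def)
    have b\<gamma>: "bdd_above ((\<lambda>s. \<gamma>' (X s)) ` {0..t})"
      using star_K_mono[OF \<gamma>' X0 B] by (rule bdd_aboveI2)
    \<comment> \<open>The supremum \<open>S\<close> need not be attained, but some \<open>X s\<close> is at least \<open>S / 2\<close>;
      this is why \<open>\<gamma>'\<close> doubles its argument.\<close>
    have "\<exists>s\<in>{0..t}. S \<le> 2 * X s"
    proof (cases "S = 0")
      case True
      then show ?thesis using X0 t by (intro bexI[of _ 0]) auto
    next
      case False
      then have "S / 2 < S" using S0 by simp
      then obtain s where "s \<in> {0..t}" "S / 2 < X s"
        using less_cSUP_iff[OF _ bX, of "S / 2"] t unfolding S_def by auto
      then show ?thesis by (intro bexI[of _ s]) auto
    qed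
    then obtain s where s: "s \<in> {0..t}" "S \<le> 2 * X s" by blast
    have "3 * \<gamma> S \<le> \<gamma>' (X s)"
      unfolding \<gamma>'_def using star_K_mono[OF \<gamma> S0 s(2)] by simp
    also have "\<dots> \<le> (SUP s\<in>{0..t}. \<gamma>' (X s))" using b\<gamma> s(1) by (rule cSUP_upper[rotated])
    finally have "3 * \<gamma> S \<le> (SUP s\<in>{0..t}. \<gamma>' (X s))" .
    then show ?thesis using le unfolding \<gamma>'X by linarith
  qed
  show ?thesis
  proof (rule exI[of _ L], rule exI[of _ \<beta>], rule exI[of _ \<gamma>'], rule exI[of _ \<gamma>'], intro conjI)
    show "\<forall>i\<in>{1..m}. L i > 0" by (rule L)
    show "class_KL \<beta>" by (rule \<beta>)
    show "class_K_inf \<gamma>'" "class_K_inf \<gamma>'" by (simp_all add: star_K_imp_class_K_inf \<gamma>')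
  qed (use main in blast)
qed

end
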